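(* Let $\mathrm{K}_V^{\mathbf t}$ be a complete $\mathbf t$-spread $d$-partite hypergraph with $|V(\mathrm{K}_V^{\mathbf t})|=r$. Then the analytic spread of its edge ideal is $\ell(I(\mathrm{K}_V^{\mathbf t}))=r-d+1$.
   Context: Setting. Let $n,d\ge 1$ be integers, $[n]=\{1,\dots,n\}$, and let $\mathbf t=(t_1,\dots,t_{d-1})$ be a vector of integers with $t_i\ge 1$ for all $i$. Let $V=\{V_1,\dots,V_d\}$ be a family of nonempty, pairwise disjoint subsets of $[n]$ such that $p<q$ whenever $p\in V_i$, $q\in V_j$ and $i<j$. A $\mathbf t$-spread edge is a set $\{k_1,\dots,k_d\}$ with $k_j\in V_j$ for $j=1,\dots,d$ and $k_j-k_{j-1}\ge t_{j-1}$ for $j=2,\dots,d$. The complete $\mathbf t$-spread $d$-partite hypergraph $\mathrm{K}_V^{\mathbf t}$ is the hypergraph with vertex set $V(\mathrm{K}_V^{\mathbf t})=V_1\cup\dots\cup V_d$ whose edges are all the $\mathbf t$-spread edges. Standing assumption: $\mathrm{K}_V^{\mathbf t}$ has no isolated vertices, i.e. every vertex belongs to at least one edge. Let $\mathbb{K}$ be a field and $S=\mathbb{K}[x_1,\dots,x_n]$. The edge ideal $I(\mathrm{K}_V^{\mathbf t})\subset S$ is the ideal generated by the monomials $x_{k_1}\cdots x_{k_d}$, where $\{k_1,\dots,k_d\}$ runs over the edges of $\mathrm{K}_V^{\mathbf t}$. Let $\mathfrak m$ be the graded maximal ideal of $S$. For an ideal $I\subset S$ with Rees algebra $\mathcal{R}(I)=\bigoplus_{j\ge0}I^jt^j\subseteq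 S[t]$, the analytic spread $\ell(I)$ is the Krull dimension of the fiber cone $\mathcal{R}(I)/\mathfrak m\mathcal{R}(I)$. *)

theory Defs
  imports
    "HOL-Algebra.Algebra"
    "HOL-Algebra.Algebraic_Closure_Type"
    "HOL-Library.Poly_Mapping"
    "HOL-Library.Extended_Nat"
    "HOL-Library.Disjoint_Sets"
begin

section \<open>Krull dimension and analytic spread\<close>

text \<open>
  The supremum of the lengths \<open>m\<close> of chains \<open>P 0 \<subset> \<dots> \<subset> P m\<close> of prime ideals.
  The zero ring gets the value \<open>0\<close>, the least element of \<^typ>\<open>enat\<close>.
\<close>

definition krull_dim :: "('a, 'b) ring_scheme \<Rightarrow> enat" where
  "krull_dim R = Sup {enat m | m. \<exists>P :: nat \<Rightarrow> 'a set.
     (\<forall>i\<le>m. primeideal (P i) R) \<and> (\<forall>i<m. P i \<subset> P (Suc i))}"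

text \<open>
  \<open>\<Oplus>\<^sub>j I\<^sup>j t\<^sup>j\<close> as a subring of \<open>R[t]\<close>; the power is the one for the product of ideals,
  with \<open>I\<^sup>0 = R\<close>.
\<close>

definition rees_algebra :: "('a, 'b) ring_scheme \<Rightarrow> 'a set \<Rightarrow> ('a, nat \<Rightarrow> 'a) up_ring" where
  "rees_algebra R I =
     (UP R)\<lparr>carrier := {p \<in> carrier (UP R). \<forall>j. up_ring.coeff (UP R) p j \<in> I [^]\<^bsub>ideals_set R\<^esub> j}\<rparr>"

text \<open>
  \<open>\<mm> \<R>(I)\<close> is the ideal of \<open>\<R>(I)\<close> generated by the elements of \<open>\<mm>\<close>, viewed as constant
  polynomials in \<open>t\<close>.
\<close>

definition fiber_cone :: "('a, 'b) ring_scheme \<Rightarrow> 'a set \<Rightarrow> 'a set \<Rightarrow> (nat \<Rightarrow> 'a) set ring" where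
  "fiber_cone R \<mm> I =
     rees_algebra R I Quot (Idl\<^bsub>rees_algebra R I\<^esub> ((\<lambda>a. up_ring.monom (UP R) a 0) ` \<mm>))"

definition analytic_spread :: "('a, 'b) ring_scheme \<Rightarrow> 'a set \<Rightarrow> 'a set \<Rightarrow> enat" where
  "analytic_spread R \<mm> I = krull_dim (fiber_cone R \<mm> I)"


section \<open>The polynomial ring in \<open>x\<^sub>1, \<dots>, x\<^sub>n\<close>\<close>

text \<open>
  A monomial is its exponent vector \<open>nat \<Rightarrow>\<^sub>0 nat\<close>, and a polynomial maps monomials to
  coefficients. The type has a variable for every natural number; the carrier of
  \<open>mpoly_ring n\<close> restricts to the variables with index in \<open>{1..n}\<close>.
\<close>

type_synonym 'k mpoly = "(nat \<Rightarrow>\<^sub>0 nat) \<Rightarrow>\<^sub>0 'k"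

definition mpoly_ring :: "nat \<Rightarrow> 'k::field mpoly ring" where
  "mpoly_ring n = ring_of_type_algebra
     \<lparr>carrier := {p. \<forall>m \<in> Poly_Mapping.keys p. Poly_Mapping.keys m \<subseteq> {1..n}}\<rparr>"

definition var :: "nat \<Rightarrow> 'k::field mpoly" where
  "var i = Poly_Mapping.single (Poly_Mapping.single i 1) 1"

definition graded_max_ideal :: "nat \<Rightarrow> 'k::field mpoly set" where
  "graded_max_ideal n = Idl\<^bsub>mpoly_ring n\<^esub> (var ` {1..n})"


section \<open>Hypergraphs and edge ideals\<close>

record 'v hypergraph =
  verts :: "'v set"
  edges :: "'v set set"

definition no_isolated_vertices :: "'v hypergraph \<Rightarrow> bool" where
  "no_isolated_vertices H \<longleftrightarrow> (\<forall>v \<in> verts H. \<exists>e \<in> edges H. v \<in> e)"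

definition edge_ideal :: "nat \<Rightarrow> nat hypergraph \<Rightarrow> 'k::field mpoly set" where
  "edge_ideal n H = Idl\<^bsub>mpoly_ring n\<^esub> ((\<lambda>e. \<Prod>i\<in>e. var i) ` edges H)"

text \<open>
  The families \<open>V\<^sub>1, \<dots>, V\<^sub>d\<close> and \<open>t\<^sub>1, \<dots>, t\<^bsub>d-1\<^esub>\<close> are functions on \<^typ>\<open>nat\<close>, used only
  at the indices \<open>1..d\<close> and \<open>1..d-1\<close>.
\<close>

definition spread_edges :: "nat \<Rightarrow> (nat \<Rightarrow> nat) \<Rightarrow> (nat \<Rightarrow> nat set) \<Rightarrow> nat set set" where
  "spread_edges d t V = {k ` {1..d} | k.
     (\<forall>j\<in>{1..d}. k j \<in> V j) \<and> (\<forall>j\<in>{2..d}. int (k j) - int (k (j - 1)) \<ge> int (t (j - 1)))}"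

definition complete_spread_hypergraph ::
    "nat \<Rightarrow> (nat \<Rightarrow> nat) \<Rightarrow> (nat \<Rightarrow> nat set) \<Rightarrow> nat hypergraph" where
  "complete_spread_hypergraph d t V =
     \<lparr>verts = (\<Union>i\<in>{1..d}. V i), edges = spread_edges d t V\<rparr>"

end

theory Submission
  imports Defs
begin

text \<open>
  All generators of the edge ideal \<open>I\<close> have degree \<open>d\<close>. Hence the fiber cone is the subalgebra
  \<open>K[M]\<close> of the polynomial ring spanned by the semigroup \<open>M\<close> of all products of edges: an element of
  the Rees algebra is sent to the sum of the components of degree \<open>j d\<close> of its coefficients at \<open>t\<^sup>j\<close>,
  and the kernel of this homomorphism is \<open>\<mm> \<R>(I)\<close> (\<open>kernel_initial_part\<close>, \<open>fiber_cone_iso\<close>). It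
  remains to see that \<open>K[M]\<close> has Krull dimension \<open>r - d + 1\<close>.

  Upper bound (\<open>krull_dim_submonoid_algebra_le\<close>). Picking \<open>x\<^sub>i \<in> P\<^bsub>i+1\<^esub> - P\<^sub>i\<close> along a chain
  \<open>P\<^sub>0 \<subset> \<dots> \<subset> P\<^sub>m\<close> of primes gives \<open>m\<close> algebraically independent elements, hence at least \<open>(N + 1)\<^sup>m\<close>
  linearly independent elements with exponents \<open>O(N)\<close>. A product of edges has the same degree in
  the variables of each \<open>V\<^sub>j\<close>, so it is determined by its exponents at all vertices but \<open>d - 1\<close>, and
  there are only \<open>O(N\<^bsup>r-d+1\<^esup>)\<close> such products. Thus \<open>m \<le> r - d + 1\<close>.

  Lower bound (\<open>krull_dim_submonoid_algebra_ge\<close>). For a set \<open>W\<close> of vertices, the elements of \<open>K[M]\<close>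
  that vanish when the variables in \<open>W\<close> are set to \<open>0\<close> form a prime. Enlarging \<open>W\<close> by a vertex
  enlarges the prime if some edge through this vertex avoids \<open>W\<close>. Eliminate \<open>V\<^sub>1\<close> from the top down
  to its minimum, then \<open>V\<^sub>2\<close>, and so on, and finally also the minimum of \<open>V\<^sub>d\<close>. At each of these
  \<open>r - d + 1\<close> steps the required edge exists: minima of the blocks already treated, the vertex
  itself, and maxima of the later blocks (\<open>staircase_edge\<close>). This is where the absence of isolated
  vertices enters.
\<close>

section \<open>Polynomials with prescribed monomials\<close>

lift_definition restrict_keys :: "'a set \<Rightarrow> ('a \<Rightarrow>\<^sub>0 'b::zero) \<Rightarrow> 'a \<Rightarrow>\<^sub>0 'b"
  is "\<lambda>T f a. if a \<in> T then f a else 0"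
  by (auto elim: rev_finite_subset)

definition polys_on :: "'a set \<Rightarrow> ('a \<Rightarrow>\<^sub>0 'b::zero) set" where
  "polys_on T = {p. Poly_Mapping.keys p \<subseteq> T}"

lemma keys_restrict_keys [simp]:
  "Poly_Mapping.keys (restrict_keys T p) = Poly_Mapping.keys p \<inter> T"
  by (auto simp: in_keys_iff restrict_keys.rep_eq split: if_splits)

lemma restrict_keys_0 [simp]: "restrict_keys T 0 = 0"
  by (rule poly_mapping_eqI) (simp add: restrict_keys.rep_eq)

lemma restrict_keys_add: 
  "restrict_keys T (p + q) = restrict_keys T p + restrict_keys T (q :: 'a \<Rightarrow>\<^sub>0 'b::comm_monoid_add)"
  by (rule poly_mapping_eqI) (simp add: restrict_keys.rep_eq lookup_add)

lemma restrict_keys_sum: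
  "restrict_keys T (sum f A) = (\<Sum>i\<in>A. restrict_keys T (f i :: 'a \<Rightarrow>\<^sub>0 'b::comm_monoid_add))"
  by (induction A rule: infinite_finite_induct) (simp_all add: restrict_keys_add)

lemma restrict_keys_id: "Poly_Mapping.keys p \<subseteq> T \<Longrightarrow> restrict_keys T p = p"
  by (rule poly_mapping_eqI) (auto simp: restrict_keys.rep_eq in_keys_iff)

lemma restrict_keys_eq_0_iff: "restrict_keys T p = 0 \<longleftrightarrow> Poly_Mapping.keys p \<inter> T = {}"
proof
  assume "restrict_keys T p = 0"
  then show "Poly_Mapping.keys p \<inter> T = {}" using keys_restrict_keys[of T p] by simp
next
  assume "Poly_Mapping.keys p \<inter> T = {}"
  then show "restrict_keys T p = 0"
    by (intro poly_mapping_eqI) (auto simp: restrict_keys.rep_eq in_keys_iff)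
qed

lemma restrict_keys_split:
  "p = restrict_keys T p + restrict_keys (- T) (p :: 'a \<Rightarrow>\<^sub>0 'b::comm_monoid_add)"
  by (rule poly_mapping_eqI) (simp add: restrict_keys.rep_eq lookup_add)

text \<open>
  Taking the lowest homogeneous component of a polynomial, and setting some of the variables
  to \<open>0\<close>, both discard all monomials outside a set \<open>T\<close>. Both are multiplicative for the same
  reason: a product of two monomials survives exactly when both factors do.
\<close>

lemma restrict_keys_mult:
  fixes p q :: "'a::comm_monoid_add \<Rightarrow>\<^sub>0 'b::comm_semiring_0"
  assumes *: "\<And>a b. a \<in> Poly_Mapping.keys p \<Longrightarrow> b \<in> Poly_Mapping.keys q \<Longrightarrow>
                a + b \<in> T \<longleftrightarrow> a \<in> T1 \<and> b \<in> T2"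
  shows "restrict_keys T (p * q) = restrict_keys T1 p * restrict_keys T2 q"
proof -
  let ?p1 = "restrict_keys T1 p" and ?p2 = "restrict_keys (- T1) p"
  let ?q1 = "restrict_keys T2 q" and ?q2 = "restrict_keys (- T2) q"
  have "p * q = (?p1 + ?p2) * (?q1 + ?q2)"
    using restrict_keys_split[of p T1] restrict_keys_split[of q T2] by simp
  also have "\<dots> = ?p1 * ?q1 + (?p1 * ?q2 + ?p2 * q)"
    using restrict_keys_split[of q T2] by (metis add.assoc distrib_left distrib_right)
  finally have "restrict_keys T (p * q) = restrict_keys T (?p1 * ?q1)
      + (restrict_keys T (?p1 * ?q2) + restrict_keys T (?p2 * q))"
    by (simp add: restrict_keys_add)
  moreover have "restrict_keys T (?p1 * ?q1) = ?p1 * ?q1"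
    using keys_mult[of ?p1 ?q1] * by (intro restrict_keys_id) auto
  moreover have "restrict_keys T (?p1 * ?q2) = 0"
    using keys_mult[of ?p1 ?q2] * by (auto simp: restrict_keys_eq_0_iff)
  moreover have "restrict_keys T (?p2 * q) = 0"
    using keys_mult[of ?p2 q] * by (auto simp: restrict_keys_eq_0_iff)
  ultimately show ?thesis by simp
qed

lemma poly_mapping_sum_single:
  "(\<Sum>m\<in>Poly_Mapping.keys p. Poly_Mapping.single m (Poly_Mapping.lookup p m)) = p"
proof (rule poly_mapping_eqI)
  fix k
  show "Poly_Mapping.lookup (\<Sum>m\<in>Poly_Mapping.keys p. Poly_Mapping.single m (Poly_Mapping.lookup p m)) k
      = Poly_Mapping.lookup p k"
    by (simp add: lookup_sum lookup_single when_def sum.delta in_keys_iff)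
qed

text \<open>
  An additively closed set of polynomials contains \<open>p\<close> as soon as it contains the terms of \<open>p\<close>.
  Membership in an ideal, or in a linear span, is checked one monomial at a time in this way.
\<close>

lemma additive_closed_monomials:
  fixes p :: "'a \<Rightarrow>\<^sub>0 'b::comm_monoid_add"
  assumes "0 \<in> J" and add: "\<And>a b. a \<in> J \<Longrightarrow> b \<in> J \<Longrightarrow> a + b \<in> J"
    and mon: "\<And>m. m \<in> Poly_Mapping.keys p \<Longrightarrow> Poly_Mapping.single m (Poly_Mapping.lookup p m) \<in> J"
  shows "p \<in> J"
proof -
  have "(\<Sum>m\<in>A. Poly_Mapping.single m (Poly_Mapping.lookup p m)) \<in> J"
    if "finite A" "A \<subseteq> Poly_Mapping.keys p" for A
    using that by (induction A) (auto intro: add mon \<open>0 \<in> J\<close>)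
  from this[OF finite_keys subset_refl] show ?thesis by (simp add: poly_mapping_sum_single)
qed

lemma polys_onI: "Poly_Mapping.keys p \<subseteq> T \<Longrightarrow> p \<in> polys_on T"
  by (simp add: polys_on_def)

lemma polys_on_0 [simp]: "0 \<in> polys_on T"
  by (simp add: polys_on_def)

lemma polys_on_add: "p \<in> polys_on T \<Longrightarrow> q \<in> polys_on T \<Longrightarrow> p + q \<in> polys_on T"
  using keys_add[of p q] by (auto simp: polys_on_def)

lemma polys_on_sum: "(\<And>i. i \<in> A \<Longrightarrow> f i \<in> polys_on T) \<Longrightarrow> sum f A \<in> polys_on T"
  by (induction A rule: infinite_finite_induct) (auto intro: polys_on_add)

lemma polys_on_uminus: "p \<in> polys_on T \<Longrightarrow> - p \<in> polys_on (T :: 'a set)"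
  for p :: "'a \<Rightarrow>\<^sub>0 'b::ab_group_add"
  by (auto simp: polys_on_def in_keys_iff)

lemma polys_on_mult:
  assumes "\<And>a b. a \<in> T1 \<Longrightarrow> b \<in> T2 \<Longrightarrow> a + b \<in> T" "p \<in> polys_on T1" "q \<in> polys_on T2"
  shows "p * q \<in> polys_on T"
  using assms keys_mult[of p q] by (fastforce simp: polys_on_def)

text \<open>
  For a submonoid \<open>T\<close> of exponent vectors this is the monoid algebra \<open>K[T]\<close>. Both the polynomial
  ring in \<open>n\<close> variables and the fiber cone will be of this form.
\<close>

definition monoid_algebra :: "'a::comm_monoid_add set \<Rightarrow> ('a \<Rightarrow>\<^sub>0 'k::comm_ring_1) ring" where
  "monoid_algebra T = ring_of_type_algebra \<lparr>carrier := polys_on T\<rparr>"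

lemma monoid_algebra_simps [simp]:
  "carrier (monoid_algebra T) = polys_on T" "\<zero>\<^bsub>monoid_algebra T\<^esub> = 0" "\<one>\<^bsub>monoid_algebra T\<^esub> = 1"
  "x \<oplus>\<^bsub>monoid_algebra T\<^esub> y = x + y" "x \<otimes>\<^bsub>monoid_algebra T\<^esub> y = x * y"
  by (simp_all add: monoid_algebra_def ring_of_type_algebra_def)

lemma monoid_algebra_cring:
  assumes "0 \<in> T" "\<And>a b. a \<in> T \<Longrightarrow> b \<in> T \<Longrightarrow> a + b \<in> T"
  shows "cring (monoid_algebra T :: ('a::comm_monoid_add \<Rightarrow>\<^sub>0 'k::comm_ring_1) ring)"
proof -
  have "\<exists>y\<in>polys_on T. y + x = 0 \<and> x + y = 0"  if "x \<in> polys_on T" for x :: "'a \<Rightarrow>\<^sub>0 'k"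
    using polys_on_uminus[OF that] by (intro bexI[of _ "-x"]) auto
  moreover have "1 \<in> polys_on T"
    using \<open>0 \<in> T\<close> by (auto simp: polys_on_def)
  ultimately show ?thesis
    using assms
    by unfold_locales (auto simp: Units_def algebra_simps intro: polys_on_add polys_on_mult)
qed

lemma monoid_algebra_uminus:
  assumes "cring (monoid_algebra T :: ('a::comm_monoid_add \<Rightarrow>\<^sub>0 'k::comm_ring_1) ring)" "x \<in> polys_on T"
  shows "\<ominus>\<^bsub>monoid_algebra T\<^esub> x = - (x :: 'a \<Rightarrow>\<^sub>0 'k)"
proof -
  interpret cring "monoid_algebra T :: ('a \<Rightarrow>\<^sub>0 'k) ring" by fact
  show ?thesis
    by (rule minus_equality) (use assms polys_on_uminus in auto)
qed

lemma monoid_algebra_finsum: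
  assumes "cring (monoid_algebra T :: ('a::comm_monoid_add \<Rightarrow>\<^sub>0 'k::comm_ring_1) ring)"
    and "\<And>i. i \<in> A \<Longrightarrow> f i \<in> polys_on T" "finite A"
  shows "finsum (monoid_algebra T) f A = (\<Sum>i\<in>A. f i :: 'a \<Rightarrow>\<^sub>0 'k)"
proof -
  interpret cring "monoid_algebra T :: ('a \<Rightarrow>\<^sub>0 'k) ring" by fact
  show ?thesis using assms(3,2)
    by (induction A rule: finite_induct) (auto simp: Pi_def)
qed

section \<open>Invariance of the Krull dimension under isomorphism\<close>

lemma krull_dim_iso_le:
  assumes R: "cring R" and S: "cring S" and h: "h \<in> ring_iso R S"
  shows "krull_dim S \<le> krull_dim R"
proof -
  interpret h: ring_hom_ring R S h
    by (rule ring_hom_ringI2) (use R S h cring.axioms(1) in \<open>auto simp: ring_iso_def\<close>)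
  have surj: "h ` carrier R = carrier S"
    using h by (simp add: ring_iso_def bij_betw_def)
  show ?thesis
    unfolding krull_dim_def
  proof (rule Sup_subset_mono, clarify)
    fix m and Q :: "nat \<Rightarrow> _ set"
    assume Q: "\<forall>i\<le>m. primeideal (Q i) S" "\<forall>i<m. Q i \<subset> Q (Suc i)"
    define P where "P i = {r \<in> carrier R. h r \<in> Q i}" for i
    have "primeideal (P i) R" if "i \<le> m" for i
      unfolding P_def using h.primeideal_vimage[OF R] Q that by blast
    moreover have "P i \<subset> P (Suc i)" if i: "i < m" for i
    proof -
      obtain s where s: "s \<in> Q (Suc i)" "s \<notin> Q i" using Q i by blast
      have "primeideal (Q (Suc i)) S" using Q i by simp
      then have "s \<in> carrier S"
        using s ideal.Icarr primeideal.axioms(1) by metis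
      then obtain r where "r \<in> carrier R" "s = h r" using surj by blast
      then show ?thesis using Q i s unfolding P_def by blast
    qed
    ultimately show "\<exists>m'. enat m = enat m' \<and>
        (\<exists>P. (\<forall>i\<le>m'. primeideal (P i) R) \<and> (\<forall>i<m'. P i \<subset> P (Suc i)))" by blast
  qed
qed

lemma krull_dim_iso:
  assumes R: "cring R" and S: "cring S" and "R \<simeq> S"
  shows "krull_dim R = krull_dim S"
proof -
  obtain h where h: "h \<in> ring_iso R S" using assms(3) by (auto simp: is_ring_iso_def)
  have "inv_into (carrier R) h \<in> ring_iso S R"
    by (rule ring_iso_set_sym[OF cring.axioms(1)[OF R] h])
  then show ?thesis
    using krull_dim_iso_le[OF R S h] krull_dim_iso_le[OF S R] by (blast intro: antisym)
qed

section \<open>Monomial ideals and their powers\<close>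

definition var_monos :: "nat \<Rightarrow> (nat \<Rightarrow>\<^sub>0 nat) set" where
  "var_monos n = {m. Poly_Mapping.keys m \<subseteq> {1..n}}"

lemma var_monos_0 [simp]: "0 \<in> var_monos n"
  by (simp add: var_monos_def)

lemma var_monos_add: "a \<in> var_monos n \<Longrightarrow> b \<in> var_monos n \<Longrightarrow> a + b \<in> var_monos n"
  using keys_add[of a b] by (auto simp: var_monos_def)

lemma mpoly_ring_eq: "mpoly_ring n = monoid_algebra (var_monos n)"
  by (simp add: mpoly_ring_def monoid_algebra_def polys_on_def var_monos_def subset_eq)

lemma mpoly_cring: "cring (monoid_algebra (var_monos n) :: ((nat \<Rightarrow>\<^sub>0 nat) \<Rightarrow>\<^sub>0 'k::field) ring)"
  by (intro monoid_algebra_cring) (auto intro: var_monos_add)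

text \<open>
  The exponents of the monomials in the ideal generated by the monomials with exponents in \<open>T\<close>.
\<close>

definition multiples :: "nat \<Rightarrow> (nat \<Rightarrow>\<^sub>0 nat) set \<Rightarrow> (nat \<Rightarrow>\<^sub>0 nat) set" where
  "multiples n T = {a + b | a b. a \<in> T \<and> b \<in> var_monos n}"

lemma multiples_add: "x \<in> multiples n T \<Longrightarrow> b \<in> var_monos n \<Longrightarrow> x + b \<in> multiples n T"
  unfolding multiples_def using var_monos_add by (force simp: add.assoc)

lemma multiples_subset_var_monos: "T \<subseteq> var_monos n \<Longrightarrow> multiples n T \<subseteq> var_monos n"
  by (auto simp: multiples_def intro: var_monos_add)

lemma subset_multiples: "T \<subseteq> multiples n T"
  unfolding multiples_def by (force intro: exI[of _ 0])

lemma ideal_polys_on_multiples: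
  assumes "T \<subseteq> var_monos n"
  shows "ideal (polys_on (multiples n T)) (monoid_algebra (var_monos n) :: ((nat \<Rightarrow>\<^sub>0 nat) \<Rightarrow>\<^sub>0 'k::field) ring)"
proof -
  interpret cring "monoid_algebra (var_monos n) :: ((nat \<Rightarrow>\<^sub>0 nat) \<Rightarrow>\<^sub>0 'k) ring" by (rule mpoly_cring)
  let ?I = "polys_on (multiples n T) :: ((nat \<Rightarrow>\<^sub>0 nat) \<Rightarrow>\<^sub>0 'k) set"
  have sub: "?I \<subseteq> polys_on (var_monos n)"
    using multiples_subset_var_monos[OF assms] by (auto simp: polys_on_def)
  have mult: "x * p \<in> ?I" if "p \<in> ?I" "x \<in> polys_on (var_monos n)" for p x
    by (rule polys_on_mult[OF _ that(2,1)]) (metis add.commute multiples_add)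
  show ?thesis
  proof (rule idealI)
    show "subgroup ?I (add_monoid (monoid_algebra (var_monos n)))"
    proof (rule add.subgroupI)
      show "?I \<subseteq> carrier (monoid_algebra (var_monos n))" using sub by simp
      show "?I \<noteq> {}" using polys_on_0 by blast
      fix a b assume "a \<in> ?I" "b \<in> ?I"
      then show "a \<oplus>\<^bsub>monoid_algebra (var_monos n)\<^esub> b \<in> ?I" by (simp add: polys_on_add)
    next
      fix a assume "a \<in> ?I"
      then show "\<ominus>\<^bsub>monoid_algebra (var_monos n)\<^esub> a \<in> ?I"
        using monoid_algebra_uminus[OF mpoly_cring, of a] sub polys_on_uminus by fastforce
    qed
  qed (use mult in \<open>auto simp: mult.commute ring_axioms\<close>)
qed

lemma genideal_monomials:
  assumes T: "T \<subseteq> var_monos n"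
  shows "Idl\<^bsub>monoid_algebra (var_monos n)\<^esub> ((\<lambda>a. Poly_Mapping.single a 1) ` T)
           = (polys_on (multiples n T) :: ((nat \<Rightarrow>\<^sub>0 nat) \<Rightarrow>\<^sub>0 'k::field) set)"
    (is "Idl\<^bsub>?R\<^esub> ?S = ?I")
proof
  interpret cring ?R by (rule mpoly_cring)
  have S: "?S \<subseteq> ?I" using subset_multiples[of T n] by (auto simp: polys_on_def)
  then show "Idl\<^bsub>?R\<^esub> ?S \<subseteq> ?I"
    by (rule genideal_minimal[OF ideal_polys_on_multiples[OF T]])
  have "?S \<subseteq> carrier ?R"
    using T by (auto simp: polys_on_def)
  then interpret J: ideal "Idl\<^bsub>?R\<^esub> ?S" ?R by (rule genideal_ideal)
  have SJ: "?S \<subseteq> Idl\<^bsub>?R\<^esub> ?S" using \<open>?S \<subseteq> carrier ?R\<close> by (rule genideal_self)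
  show "?I \<subseteq> Idl\<^bsub>?R\<^esub> ?S"
  proof
    fix p :: "(nat \<Rightarrow>\<^sub>0 nat) \<Rightarrow>\<^sub>0 'k" assume p: "p \<in> ?I"
    show "p \<in> Idl\<^bsub>?R\<^esub> ?S"
    proof (rule additive_closed_monomials)
      fix m assume "m \<in> Poly_Mapping.keys p"
      then obtain a b where m: "m = a + b" "a \<in> T" "b \<in> var_monos n"
        using p by (auto simp: polys_on_def multiples_def)
      have "Poly_Mapping.single b (Poly_Mapping.lookup p m) \<in> carrier ?R"
        using m by (auto simp: polys_on_def)
      from J.I_l_closed[OF _ this, of "Poly_Mapping.single a 1"] SJ m
      show "Poly_Mapping.single m (Poly_Mapping.lookup p m) \<in> Idl\<^bsub>?R\<^esub> ?S"
        by (auto simp: mult_single add.commute)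
    qed (use J.zero_closed J.a_closed in auto)
  qed
qed

primrec nfold_sums :: "'a::comm_monoid_add set \<Rightarrow> nat \<Rightarrow> 'a set" where
  "nfold_sums G 0 = {0}"
| "nfold_sums G (Suc j) = {a + b | a b. a \<in> nfold_sums G j \<and> b \<in> G}"

lemma nfold_sums_add:
  "a \<in> nfold_sums G i \<Longrightarrow> b \<in> nfold_sums G j \<Longrightarrow> a + b \<in> nfold_sums G (i + j)"
  by (induction j arbitrary: b) (auto, metis add.assoc)

lemma nfold_sums_submonoid:
  "0 \<in> (\<Union>j. nfold_sums G j)"
  "a \<in> (\<Union>j. nfold_sums G j) \<Longrightarrow> b \<in> (\<Union>j. nfold_sums G j) \<Longrightarrow> a + b \<in> (\<Union>j. nfold_sums G j)"
proof -
  have "0 \<in> nfold_sums G 0" by simp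
  then show "0 \<in> (\<Union>j. nfold_sums G j)" by blast
qed (use nfold_sums_add in blast)

lemma nfold_sums_1: "nfold_sums G (Suc 0) = G"
  by auto

lemma nfold_sums_var_monos: "G \<subseteq> var_monos n \<Longrightarrow> nfold_sums G j \<subseteq> var_monos n"
  by (induction j) (auto intro: var_monos_add)

lemma ideal_prod_monomial:
  assumes T: "T1 \<subseteq> var_monos n" "T2 \<subseteq> var_monos n"
  shows "polys_on (multiples n T1) \<cdot>\<^bsub>monoid_algebra (var_monos n)\<^esub> polys_on (multiples n T2)
    = (polys_on (multiples n {a + b | a b. a \<in> T1 \<and> b \<in> T2}) :: ((nat \<Rightarrow>\<^sub>0 nat) \<Rightarrow>\<^sub>0 'k::field) set)"
    (is "?L = ?I")
proof
  let ?R = "monoid_algebra (var_monos n) :: ((nat \<Rightarrow>\<^sub>0 nat) \<Rightarrow>\<^sub>0 'k) ring"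
  interpret cring ?R by (rule mpoly_cring)
  interpret L: ideal ?L ?R
    by (intro ideal_prod_is_ideal ideal_polys_on_multiples T)
  have sum: "x + y \<in> multiples n {a + b | a b. a \<in> T1 \<and> b \<in> T2}"
    if "x \<in> multiples n T1" "y \<in> multiples n T2" for x y
  proof -
    from that obtain a b c d where "x = a + b" "a \<in> T1" "b \<in> var_monos n"
      "y = c + d" "c \<in> T2" "d \<in> var_monos n" by (auto simp: multiples_def)
    moreover have "(a + b) + (c + d) = (a + c) + (b + d)" by (simp add: algebra_simps)
    ultimately show ?thesis using var_monos_add unfolding multiples_def by blast
  qed
  show "?L \<subseteq> ?I"
  proof
    fix x assume "x \<in> ?L"
    then show "x \<in> ?I"
      by induction (auto intro: polys_on_add polys_on_mult[OF sum])
  qed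
  show "?I \<subseteq> ?L"
  proof
    fix p :: "(nat \<Rightarrow>\<^sub>0 nat) \<Rightarrow>\<^sub>0 'k" assume p: "p \<in> ?I"
    show "p \<in> ?L"
    proof (rule additive_closed_monomials)
      fix m assume "m \<in> Poly_Mapping.keys p"
      then obtain a b c where m: "m = a + b + c" "a \<in> T1" "b \<in> T2" "c \<in> var_monos n"
        using p by (auto simp: polys_on_def multiples_def)
      have "Poly_Mapping.single a (1::'k) \<otimes>\<^bsub>?R\<^esub> Poly_Mapping.single (b + c) (Poly_Mapping.lookup p m) \<in> ?L"
        using m subset_multiples[of T1 n]
        by (intro ideal_prod.prod) (auto simp: polys_on_def multiples_def)
      then show "Poly_Mapping.single m (Poly_Mapping.lookup p m) \<in> ?L"
        using m by (simp add: mult_single add.assoc)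
    qed (use L.zero_closed L.a_closed in auto)
  qed
qed

text \<open>
  The power is the one of the monoid of ideals under the product of ideals, so the claim reduces
  to the product of two monomial ideals; \<open>I\<^sup>0\<close> is the whole ring because every monomial is a
  multiple of \<open>1\<close>.
\<close>

lemma monomial_ideal_power:
  assumes "G \<subseteq> var_monos n"
  shows "polys_on (multiples n G) [^]\<^bsub>ideals_set (monoid_algebra (var_monos n))\<^esub> j
    = (polys_on (multiples n (nfold_sums G j)) :: ((nat \<Rightarrow>\<^sub>0 nat) \<Rightarrow>\<^sub>0 'k::field) set)"
proof (induction j)
  case 0
  have "multiples n {0} = var_monos n" by (auto simp: multiples_def)
  then show ?case by (simp add: ideals_set_def)
next
  case (Suc j)
  then show ?case 
    using ideal_prod_monomial[OF nfold_sums_var_monos[OF assms, of j] assms]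
    by (simp add: nat_pow_def ideals_set_def)
qed

section \<open>The fiber cone of an equigenerated monomial ideal\<close>

definition mdeg :: "nat \<Rightarrow> (nat \<Rightarrow>\<^sub>0 nat) \<Rightarrow> nat" where
  "mdeg n m = (\<Sum>i\<in>{1..n}. Poly_Mapping.lookup m i)"

lemma mdeg_add [simp]: "mdeg n (a + b) = mdeg n a + mdeg n b"
  by (simp add: mdeg_def lookup_add sum.distrib)

lemma mdeg_0 [simp]: "mdeg n 0 = 0"
  by (simp add: mdeg_def)

lemma mdeg_eq_0_iff:
  assumes "m \<in> var_monos n"
  shows "mdeg n m = 0 \<longleftrightarrow> m = 0"
proof
  assume "mdeg n m = 0"
  with assms have m: "m \<in> var_monos n" "mdeg n m = 0" by auto
  have "Poly_Mapping.lookup m i = 0" for i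
  proof (cases "i \<in> {1..n}")
    case True
    then show ?thesis using m(2) unfolding mdeg_def by (subst (asm) sum_eq_0_iff) auto
  next
    case False
    then have "i \<notin> Poly_Mapping.keys m" using m(1) unfolding var_monos_def by blast
    then show ?thesis by (simp add: in_keys_iff)
  qed
  then show "m = 0" by (intro poly_mapping_eqI) simp
qed simp

text \<open>
  The setting of a monomial ideal whose generators all have the same degree \<open>e\<close>. Then \<open>I\<^sup>j\<close> starts
  in degree \<open>j * e\<close>, and \<open>\<mm> I\<^sup>j\<close> consists of the elements of \<open>I\<^sup>j\<close> without component in this
  degree. So the fiber cone \<open>\<Oplus>\<^sub>j I\<^sup>j / \<mm> I\<^sup>j\<close> is spanned by the products of \<open>j\<close> generators, and it
  is the algebra of the semigroup that the generators span. The type argument fixes the field.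
\<close>

locale equigenerated =
  fixes n e :: nat and G :: "(nat \<Rightarrow>\<^sub>0 nat) set" and field_type :: "'k::field itself"
  assumes G_monos: "G \<subseteq> var_monos n" and G_deg: "\<And>m. m \<in> G \<Longrightarrow> mdeg n m = e"
    and e_pos: "e \<ge> 1"
begin

abbreviation "R \<equiv> monoid_algebra (var_monos n) :: ((nat \<Rightarrow>\<^sub>0 nat) \<Rightarrow>\<^sub>0 'k) ring"
abbreviation "I \<equiv> polys_on (multiples n G) :: ((nat \<Rightarrow>\<^sub>0 nat) \<Rightarrow>\<^sub>0 'k) set"
abbreviation "Rees \<equiv> rees_algebra R I"
abbreviation "L j \<equiv> polys_on (multiples n (nfold_sums G j)) :: ((nat \<Rightarrow>\<^sub>0 nat) \<Rightarrow>\<^sub>0 'k) set"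

sublocale cring R by (rule mpoly_cring)

lemma mdeg_nfold: "m \<in> nfold_sums G j \<Longrightarrow> mdeg n m = j * e"
  by (induction j arbitrary: m) (auto simp: G_deg)

lemma mdeg_multiples: "m \<in> multiples n (nfold_sums G j) \<Longrightarrow> mdeg n m \<ge> j * e"
  by (auto simp: multiples_def mdeg_nfold)

lemma multiples_bottom:
  "m \<in> multiples n (nfold_sums G j) \<Longrightarrow> mdeg n m = j * e \<Longrightarrow> m \<in> nfold_sums G j"
  by (auto simp: multiples_def mdeg_nfold mdeg_eq_0_iff)

lemma L_subset: "L j \<subseteq> polys_on (var_monos n)"
  using multiples_subset_var_monos[OF nfold_sums_var_monos[OF G_monos, of j]] by (auto simp: polys_on_def)

lemma L_0: "L 0 = polys_on (var_monos n)"
proof -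
  have "multiples n {0} = var_monos n" by (auto simp: multiples_def)
  then show ?thesis by simp
qed

lemma L_mult:
  assumes "f \<in> L i" "g \<in> L j"
  shows "f * g \<in> L (i + j)"
proof (rule polys_on_mult[OF _ assms])
  fix x y assume "x \<in> multiples n (nfold_sums G i)" "y \<in> multiples n (nfold_sums G j)"
  then obtain a b c d where "x = a + b" "a \<in> nfold_sums G i" "b \<in> var_monos n"
    "y = c + d" "c \<in> nfold_sums G j" "d \<in> var_monos n" by (auto simp: multiples_def)
  moreover have "(a + b) + (c + d) = (a + c) + (b + d)" by (simp add: algebra_simps)
  ultimately show "x + y \<in> multiples n (nfold_sums G (i + j))"
    unfolding multiples_def using var_monos_add nfold_sums_add by blast
qed

lemma up_iff: "p \<in> up R \<longleftrightarrow> (\<forall>j. p j \<in> polys_on (var_monos n)) \<and> (\<exists>N. \<forall>j>N. p j = 0)"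
  by (auto simp: up_def bound_def Pi_def)

lemma rees_carrier: "p \<in> carrier Rees \<longleftrightarrow> (\<forall>j. p j \<in> L j) \<and> (\<exists>N. \<forall>j>N. p j = 0)"
proof -
  have "p \<in> carrier Rees \<longleftrightarrow> p \<in> up R \<and> (\<forall>j. p j \<in> L j)"
    by (auto simp: rees_algebra_def UP_def monomial_ideal_power[OF G_monos])
  then show ?thesis using L_subset by (auto simp: up_iff)
qed

lemma rees_up: "p \<in> carrier Rees \<Longrightarrow> p \<in> up R"
  using L_subset by (auto simp: rees_carrier up_iff)

lemma UP_mult: 
  assumes "p \<in> up R" "q \<in> up R"
  shows "p \<otimes>\<^bsub>UP R\<^esub> q = (\<lambda>j. \<Sum>i\<le>j. p i * q (j - i))"
proof
  fix j
  have "finsum R (\<lambda>i. p i * q (j - i)) {..j} = (\<Sum>i\<le>j. p i * q (j - i))"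
    by (rule monoid_algebra_finsum[OF mpoly_cring])
       (use assms in \<open>auto simp: up_iff intro!: polys_on_mult[of "var_monos n" "var_monos n"] var_monos_add\<close>)
  then show "(p \<otimes>\<^bsub>UP R\<^esub> q) j = (\<Sum>i\<le>j. p i * q (j - i))"
    using assms by (simp add: UP_def)
qed

lemma rees_ops:
  "p \<in> carrier Rees \<Longrightarrow> q \<in> carrier Rees \<Longrightarrow> p \<otimes>\<^bsub>Rees\<^esub> q = (\<lambda>j. \<Sum>i\<le>j. p i * q (j - i))"
  "p \<in> carrier Rees \<Longrightarrow> q \<in> carrier Rees \<Longrightarrow> p \<oplus>\<^bsub>Rees\<^esub> q = (\<lambda>j. p j + q j)"
  "\<one>\<^bsub>Rees\<^esub> = (\<lambda>j. if j = 0 then 1 else 0)"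
  "\<zero>\<^bsub>Rees\<^esub> = (\<lambda>j. 0)"
proof -
  assume pq: "p \<in> carrier Rees" "q \<in> carrier Rees"
  show "p \<otimes>\<^bsub>Rees\<^esub> q = (\<lambda>j. \<Sum>i\<le>j. p i * q (j - i))"
    using UP_mult[OF pq[THEN rees_up]] by (simp add: rees_algebra_def)
  show "p \<oplus>\<^bsub>Rees\<^esub> q = (\<lambda>j. p j + q j)"
    using pq[THEN rees_up] by (simp add: rees_algebra_def UP_def)
qed (simp_all add: rees_algebra_def UP_def fun_eq_iff)

lemma UP_ops:
  "carrier (UP R) = up R"
  "\<one>\<^bsub>UP R\<^esub> = (\<lambda>j. if j = 0 then 1 else 0)"
  "p \<in> up R \<Longrightarrow> q \<in> up R \<Longrightarrow> p \<oplus>\<^bsub>UP R\<^esub> q = (\<lambda>j. p j + q j)"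
  "p \<in> up R \<Longrightarrow> up_ring.coeff (UP R) p j = p j"
  by (simp_all add: UP_def fun_eq_iff)

lemma rees_cring: "cring Rees"
proof -
  interpret P: cring "UP R"
    by (rule UP_cring.UP_cring) (simp add: UP_cring_def mpoly_cring)
  have UP: "UP_ring R" using ring_axioms by (simp add: UP_ring_def)
  let ?H = "carrier Rees"
  have carr: "h \<in> carrier (UP R)" if "h \<in> ?H" for h
    unfolding UP_ops by (rule rees_up[OF that])
  have "subring ?H (UP R)"
  proof (rule P.subringI)
    show "?H \<subseteq> carrier (UP R)" using carr by blast
  next
    have "1 \<in> L 0" by (subst L_0) (simp add: polys_on_def)
    then show "\<one>\<^bsub>UP R\<^esub> \<in> ?H"
      unfolding rees_carrier UP_ops by (intro conjI allI exI[of _ 0]) auto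
  next
    fix h assume h: "h \<in> ?H"
    have "\<ominus>\<^bsub>UP R\<^esub> h \<in> up R" using P.a_inv_closed[OF carr[OF h]] unfolding UP_ops .
    moreover have "(\<ominus>\<^bsub>UP R\<^esub> h) j = - h j" for j
    proof -
      have "(\<ominus>\<^bsub>UP R\<^esub> h) j = \<ominus>\<^bsub>R\<^esub> (h j)"
        using UP_ring.coeff_a_inv[OF UP, OF carr[OF h], of j]
        unfolding UP_ops(4)[OF calculation] UP_ops(4)[OF rees_up[OF h]] .
      also have "\<dots> = - h j"
        using rees_up[OF h] by (intro monoid_algebra_uminus[OF mpoly_cring]) (simp add: up_iff)
      finally show ?thesis .
    qed
    ultimately show "\<ominus>\<^bsub>UP R\<^esub> h \<in> ?H"
      using h polys_on_uminus[of "h j" for j] unfolding rees_carrier up_iff by simp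
  next
    fix p q assume pq: "p \<in> ?H" "q \<in> ?H"
    then have L: "p j \<in> L j" "q j \<in> L j" for j unfolding rees_carrier by blast+
    have "p \<otimes>\<^bsub>UP R\<^esub> q \<in> up R"
      using P.m_closed[OF pq[THEN carr]] unfolding UP_ops .
    moreover have "(p \<otimes>\<^bsub>UP R\<^esub> q) j \<in> L j" for j
      unfolding UP_mult[OF pq[THEN rees_up]] 
    proof (rule polys_on_sum)
      fix i assume "i \<in> {..j}"
      then show "p i * q (j - i) \<in> L j" using L_mult[OF L(1)[of i] L(2)[of "j - i"]] by simp
    qed
    ultimately show "p \<otimes>\<^bsub>UP R\<^esub> q \<in> ?H"
      unfolding rees_carrier up_iff by blast
    have "p \<oplus>\<^bsub>UP R\<^esub> q \<in> up R"
      using P.a_closed[OF pq[THEN carr]] unfolding UP_ops .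
    then show "p \<oplus>\<^bsub>UP R\<^esub> q \<in> ?H"
      using L unfolding rees_carrier up_iff UP_ops(3)[OF pq[THEN rees_up]]
      by (metis polys_on_add)
  qed
  then have "cring ((UP R)\<lparr>carrier := ?H\<rparr>)"
    using P.subcring_iff[of ?H] carr P.subcringI'[of ?H] by blast
  then show ?thesis unfolding rees_algebra_def by simp
qed

definition slice :: "nat \<Rightarrow> ((nat \<Rightarrow>\<^sub>0 nat) \<Rightarrow>\<^sub>0 'k) \<Rightarrow> ((nat \<Rightarrow>\<^sub>0 nat) \<Rightarrow>\<^sub>0 'k)" where
  "slice j = restrict_keys {m. mdeg n m = j * e}"

text \<open>
  Sends an element of the Rees algebra to the sum of the lowest possible components of its
  coefficients, of degree \<open>j * e\<close> in the coefficient of \<open>t\<^sup>j\<close>. The power of \<open>t\<close> may be forgotten: for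
  \<open>e \<ge> 1\<close> the degree of a monomial already determines \<open>j\<close>.
\<close>

definition initial_part :: "(nat \<Rightarrow> ((nat \<Rightarrow>\<^sub>0 nat) \<Rightarrow>\<^sub>0 'k)) \<Rightarrow> ((nat \<Rightarrow>\<^sub>0 nat) \<Rightarrow>\<^sub>0 'k)" where
  "initial_part p = (\<Sum>j | p j \<noteq> 0. slice j (p j))"

lemma slice_0 [simp]: "slice j 0 = 0"
  by (simp add: slice_def)

lemma initial_part_eq:
  assumes "\<And>j. j > N \<Longrightarrow> p j = 0"
  shows "initial_part p = (\<Sum>j\<le>N. slice j (p j))"
  unfolding initial_part_def
  by (rule sum.mono_neutral_left) (use assms in \<open>auto simp: not_le[symmetric]\<close>)

lemma slice_mult:
  assumes "f \<in> L i" "g \<in> L j"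
  shows "slice (i + j) (f * g) = slice i f * slice j g"
  unfolding slice_def
proof (rule restrict_keys_mult)
  fix a b assume "a \<in> Poly_Mapping.keys f" "b \<in> Poly_Mapping.keys g"
  then have "mdeg n a \<ge> i * e" "mdeg n b \<ge> j * e"
    using assms mdeg_multiples by (auto simp: polys_on_def)
  then show "(a + b \<in> {m. mdeg n m = (i + j) * e}) =
      (a \<in> {m. mdeg n m = i * e} \<and> b \<in> {m. mdeg n m = j * e})"
    by (auto simp: algebra_simps)
qed

lemma slice_L: "f \<in> L j \<Longrightarrow> slice j f \<in> polys_on (nfold_sums G j)"
  using multiples_bottom by (auto simp: slice_def polys_on_def)

abbreviation "T \<equiv> monoid_algebra UNIV :: ((nat \<Rightarrow>\<^sub>0 nat) \<Rightarrow>\<^sub>0 'k) ring"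
abbreviation "M \<equiv> (\<Union>j. nfold_sums G j)"

lemma initial_part_hom: "initial_part \<in> ring_hom Rees T"
proof (rule ring_hom_memI)
  fix p q assume pq: "p \<in> carrier Rees" "q \<in> carrier Rees"
  obtain N1 where N1: "\<And>j. j > N1 \<Longrightarrow> p j = 0" using pq by (auto simp: rees_carrier)
  obtain N2 where N2: "\<And>j. j > N2 \<Longrightarrow> q j = 0" using pq by (auto simp: rees_carrier)
  show "initial_part (p \<oplus>\<^bsub>Rees\<^esub> q) = initial_part p \<oplus>\<^bsub>T\<^esub> initial_part q"
    using initial_part_eq[of "N1 + N2" p] initial_part_eq[of "N1 + N2" q]
      initial_part_eq[of "N1 + N2" "\<lambda>j. p j + q j"] N1 N2
    by (simp add: rees_ops(1,2)[OF pq] sum.distrib slice_def restrict_keys_add)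
  \<comment> \<open>The product formula for univariate polynomials, evaluated at \<open>1\<close>.\<close>
  have "(\<Sum>i\<le>N1. slice i (p i) * 1 ^ i) * (\<Sum>j\<le>N2. slice j (q j) * 1 ^ j)
      = (\<Sum>r\<le>N1 + N2. (\<Sum>k\<le>r. slice k (p k) * slice (r - k) (q (r - k))) * 1 ^ r)"
    by (rule polynomial_product) (use N1 N2 in auto)
  then have "initial_part p * initial_part q
      = (\<Sum>r\<le>N1 + N2. (\<Sum>k\<le>r. slice k (p k) * slice (r - k) (q (r - k))))"
    using initial_part_eq[of N1 p] initial_part_eq[of N2 q] N1 N2 by simp
  also have "\<dots> = (\<Sum>r\<le>N1 + N2. (\<Sum>k\<le>r. slice r (p k * q (r - k))))"
  proof (intro sum.cong refl)
    fix r k :: nat assume "k \<in> {..r}"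
    then show "slice k (p k) * slice (r - k) (q (r - k)) = slice r (p k * q (r - k))"
      using slice_mult[of "p k" k "q (r - k)" "r - k"] pq by (auto simp: rees_carrier)
  qed
  also have "\<dots> = (\<Sum>r\<le>N1 + N2. slice r (\<Sum>k\<le>r. p k * q (r - k)))"
    by (simp add: slice_def restrict_keys_sum)
  also have "\<dots> = initial_part (\<lambda>r. \<Sum>k\<le>r. p k * q (r - k))"
  proof (rule initial_part_eq[symmetric])
    fix r assume r: "r > N1 + N2"
    show "(\<Sum>k\<le>r. p k * q (r - k)) = 0"
    proof (rule sum.neutral, rule ballI)
      fix k show "p k * q (r - k) = 0"
        using N1[of k] N2[of "r - k"] r by (cases "k > N1") auto
    qed
  qed
  finally show "initial_part (p \<otimes>\<^bsub>Rees\<^esub> q) = initial_part p \<otimes>\<^bsub>T\<^esub> initial_part q"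
    by (simp add: rees_ops(1,2)[OF pq])
next
  have "initial_part (\<lambda>j. if j = 0 then 1 else 0) = slice 0 1"
    using initial_part_eq[of 0 "\<lambda>j. if j = 0 then 1 else 0"] by simp
  also have "\<dots> = 1"
    unfolding slice_def by (rule restrict_keys_id) simp
  finally show "initial_part \<one>\<^bsub>Rees\<^esub> = \<one>\<^bsub>T\<^esub>"
    by (simp add: rees_ops(3))
qed (simp add: polys_on_def)

lemma le_mult_e: "j \<le> j * e"
  using e_pos by (cases e) auto

text \<open>
  Surjectivity is seen by splitting a polynomial \<open>f\<close> with monomials in the semigroup into its
  homogeneous components: the component of degree \<open>j * e\<close> lies in \<open>I\<^sup>j\<close>, so these components are the
  coefficients of a preimage.
\<close>

lemma initial_part_image: "initial_part ` carrier Rees = polys_on M"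
proof
  show "initial_part ` carrier Rees \<subseteq> polys_on M"
  proof
    fix f assume "f \<in> initial_part ` carrier Rees"
    then obtain p where p: "p \<in> carrier Rees" "f = initial_part p" by auto
    have "slice j (p j) \<in> polys_on M" for j
      using slice_L[of "p j" j] p(1) unfolding rees_carrier by (auto simp: polys_on_def)
    then show "f \<in> polys_on M"
      unfolding p initial_part_def by (intro polys_on_sum)
  qed
  show "polys_on M \<subseteq> initial_part ` carrier Rees"
  proof
    fix f :: "(nat \<Rightarrow>\<^sub>0 nat) \<Rightarrow>\<^sub>0 'k" assume f: "f \<in> polys_on M"
    define N where "N = (\<Sum>m\<in>Poly_Mapping.keys f. mdeg n m)"
    have N: "mdeg n m \<le> N" if "m \<in> Poly_Mapping.keys f" for m
      unfolding N_def by (rule member_le_sum) (use that in auto)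
    have N': "j \<le> N" if "slice j f \<noteq> 0" for j
    proof -
      from that obtain m where m: "m \<in> Poly_Mapping.keys f" "mdeg n m = j * e"
        by (auto simp: slice_def restrict_keys_eq_0_iff)
      from N[OF m(1)] show ?thesis unfolding m(2) by (rule le_trans[OF le_mult_e])
    qed
    have inL: "slice j f \<in> L j" for j
    proof (rule polys_onI)
      have "m \<in> nfold_sums G j" if "m \<in> Poly_Mapping.keys f" "mdeg n m = j * e" for m
        using f that mdeg_nfold[of m] e_pos by (auto simp: polys_on_def)
      then show "Poly_Mapping.keys (slice j f) \<subseteq> multiples n (nfold_sums G j)"
        using subset_multiples[of "nfold_sums G j" n] by (auto simp: slice_def)
    qed
    have "initial_part (\<lambda>j. slice j f) = (\<Sum>j\<le>N. slice j (slice j f))"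
      by (rule initial_part_eq) (use N' in \<open>auto simp: not_le[symmetric]\<close>)
    also have "\<dots> = (\<Sum>j\<le>N. slice j f)"
      by (intro sum.cong refl) (auto simp: slice_def intro: restrict_keys_id)
    also have "\<dots> = f"
    proof (rule poly_mapping_eqI)
      fix m
      have "Poly_Mapping.lookup (\<Sum>j\<le>N. slice j f) m
          = (\<Sum>j\<le>N. if mdeg n m = j * e then Poly_Mapping.lookup f m else 0)"
        by (simp add: lookup_sum slice_def restrict_keys.rep_eq)
      also have "\<dots> = Poly_Mapping.lookup f m"
      proof (cases "m \<in> Poly_Mapping.keys f")
        case True
        then obtain k where k: "mdeg n m = k * e"
          using f mdeg_nfold by (fastforce simp: polys_on_def)
        have "k \<le> N" using N[OF True] unfolding k by (rule le_trans[OF le_mult_e])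
        have "(\<Sum>j\<le>N. if mdeg n m = j * e then Poly_Mapping.lookup f m else 0)
            = (\<Sum>j\<le>N. if j = k then Poly_Mapping.lookup f m else 0)"
          using k e_pos by (intro sum.cong) auto
        then show ?thesis using \<open>k \<le> N\<close> by simp
      next
        case False
        then show ?thesis by (intro trans[OF sum.neutral]) (auto simp: in_keys_iff)
      qed
      finally show "Poly_Mapping.lookup (\<Sum>j\<le>N. slice j f) m = Poly_Mapping.lookup f m" .
    qed
    finally have "f = initial_part (\<lambda>j. slice j f)" by simp
    moreover have "(\<lambda>j. slice j f) \<in> carrier Rees"
      using inL N' unfolding rees_carrier by (metis linorder_not_le)
    ultimately show "f \<in> initial_part ` carrier Rees" by blast
  qed
qed

end

context equigenerated
begin

definition units :: "(nat \<Rightarrow>\<^sub>0 nat) set" where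
  "units = (\<lambda>i. Poly_Mapping.single i 1) ` {1..n}"

lemma units_var_monos: "units \<subseteq> var_monos n"
  by (auto simp: units_def var_monos_def)

lemma graded_max_ideal_eq: "graded_max_ideal n = (polys_on (multiples n units) :: ((nat \<Rightarrow>\<^sub>0 nat) \<Rightarrow>\<^sub>0 'k) set)"
proof -
  have "var ` {1..n} = (\<lambda>a. Poly_Mapping.single a (1::'k)) ` units"
    by (simp add: units_def image_image var_def)
  then show ?thesis
    unfolding graded_max_ideal_def mpoly_ring_eq using genideal_monomials[OF units_var_monos] by metis
qed

lemma zero_not_multiple: "0 \<notin> multiples n units"
proof
  assume "0 \<in> multiples n units"
  then obtain a b where ab: "0 = a + b" "a \<in> units" unfolding multiples_def by blast
  have "mdeg n a + mdeg n b = 0" unfolding mdeg_add[symmetric] ab(1)[symmetric] by (rule mdeg_0)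
  then have "mdeg n a = 0" by (rule add_is_0[THEN iffD1, THEN conjunct1])
  then have "a = 0" using mdeg_eq_0_iff units_var_monos ab(2) by blast
  moreover obtain i where "a = Poly_Mapping.single i 1" using ab(2) unfolding units_def by blast
  ultimately have "Poly_Mapping.lookup (Poly_Mapping.single i (1::nat)) i = 0" by simp
  then show False by simp
qed

lemma var_monos_split:
  assumes "b \<in> var_monos n" "b \<noteq> 0"
  obtains i b' where "i \<in> {1..n}" "b' \<in> var_monos n" "b = Poly_Mapping.single i 1 + b'"
proof -
  obtain i where i: "i \<in> Poly_Mapping.keys b" using assms(2) by (metis all_not_in_conv keys_eq_empty)
  define b' where "b' = b - Poly_Mapping.single i 1"
  have bi: "Poly_Mapping.lookup b i \<noteq> 0" using i unfolding in_keys_iff .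
  have "b = Poly_Mapping.single i 1 + b'"
  proof (rule poly_mapping_eqI)
    fix k
    show "Poly_Mapping.lookup b k = Poly_Mapping.lookup (Poly_Mapping.single i 1 + b') k"
      unfolding b'_def lookup_add lookup_minus using bi by (cases "i = k") (simp_all add: lookup_single)
  qed
  moreover have "Poly_Mapping.keys b' \<subseteq> Poly_Mapping.keys b"
  proof
    fix k assume "k \<in> Poly_Mapping.keys b'"
    then have "Poly_Mapping.lookup b k - Poly_Mapping.lookup (Poly_Mapping.single i 1) k \<noteq> 0"
      unfolding b'_def in_keys_iff lookup_minus .
    then show "k \<in> Poly_Mapping.keys b" unfolding in_keys_iff by auto
  qed
  then have "b' \<in> var_monos n" using assms(1) unfolding var_monos_def by blast
  moreover have "i \<in> {1..n}" using i assms(1) unfolding var_monos_def by blast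
  ultimately show thesis using that by blast
qed

definition const_poly :: "((nat \<Rightarrow>\<^sub>0 nat) \<Rightarrow>\<^sub>0 'k) \<Rightarrow> nat \<Rightarrow> ((nat \<Rightarrow>\<^sub>0 nat) \<Rightarrow>\<^sub>0 'k)" where
  "const_poly a = (\<lambda>j. if j = 0 then a else 0)"

abbreviation "mR \<equiv> Idl\<^bsub>Rees\<^esub> (const_poly ` polys_on (multiples n units))"

lemma mmax_subset: "polys_on (multiples n units) \<subseteq> polys_on (var_monos n)"
  using multiples_subset_var_monos[OF units_var_monos] unfolding polys_on_def by blast

lemma mR_eq: "Idl\<^bsub>Rees\<^esub> ((\<lambda>a. up_ring.monom (UP R) a 0) ` polys_on (multiples n units)) = mR"
proof -
  have "up_ring.monom (UP R) a 0 = const_poly a" if "a \<in> polys_on (multiples n units)" for a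
    using that mmax_subset by (auto simp: UP_def const_poly_def fun_eq_iff)
  then have "(\<lambda>a. up_ring.monom (UP R) a 0) ` polys_on (multiples n units) = const_poly ` polys_on (multiples n units)"
    by (rule image_cong[OF refl])
  then show ?thesis by simp
qed

lemma rees_term:
  assumes "f \<in> L k"
  shows "(\<lambda>j. if j = k then f else 0) \<in> carrier Rees"
  unfolding rees_carrier using assms by (intro conjI allI exI[of _ k]) auto

lemma const_poly_rees: "a \<in> polys_on (var_monos n) \<Longrightarrow> const_poly a \<in> carrier Rees"
  unfolding const_poly_def by (rule rees_term) (subst L_0)

lemma ring_hom_ring_initial_part: "ring_hom_ring Rees T initial_part"
proof (rule ring_hom_ringI2)
  show "ring Rees" using rees_cring by (rule cring.axioms(1))
  show "ring T" by (intro cring.axioms(1) monoid_algebra_cring) auto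
qed (rule initial_part_hom)

lemma kernel_slices:
  assumes p: "p \<in> carrier Rees" and 0: "initial_part p = 0"
  shows "slice j (p j) = 0"
proof -
  obtain N where N: "\<And>j. j > N \<Longrightarrow> p j = 0" using p unfolding rees_carrier by blast
  have "slice j (slice i (p i)) = (if i = j then slice j (p j) else 0)" for i
    using e_pos by (auto simp: slice_def restrict_keys_eq_0_iff intro!: restrict_keys_id)
  then have "slice j (initial_part p) = (\<Sum>i\<le>N. if i = j then slice j (p j) else 0)"
    using initial_part_eq[of N p, OF N] by (simp add: slice_def restrict_keys_sum)
  also have "\<dots> = slice j (p j)" using N[of j] by (auto simp: not_le)
  finally show ?thesis using 0 by simp
qed

text \<open>
  A monomial \<open>m\<close> of the \<open>j\<close>-th coefficient that is not of lowest degree is a product of \<open>j\<close>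
  generators times a nontrivial monomial. Splitting off a variable \<open>x\<^sub>i\<close> from the latter writes
  \<open>m t\<^sup>j\<close> as \<open>x\<^sub>i\<close> times an element of the Rees algebra. The induction removes these terms one by
  one and is on their number.
\<close>

lemma kernel_subset_mR:
  assumes "p \<in> carrier Rees" "\<And>j. slice j (p j) = 0"
  shows "p \<in> mR"
proof -
  interpret rees: ring Rees using rees_cring by (rule cring.axioms(1))
  have gens: "const_poly ` polys_on (multiples n units) \<subseteq> carrier Rees"
    using const_poly_rees mmax_subset by blast
  have J: "ideal mR Rees" by (rule rees.genideal_ideal[OF gens])
  have gJ: "const_poly ` polys_on (multiples n units) \<subseteq> mR" by (rule rees.genideal_self[OF gens])
  obtain N where N: "\<And>j. j > N \<Longrightarrow> p j = 0" using assms(1) unfolding rees_carrier by blast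
  show ?thesis using assms N
  proof (induction "card (SIGMA j:{..N}. Poly_Mapping.keys (p j))" arbitrary: p)
    case 0
    have "finite (SIGMA j:{..N}. Poly_Mapping.keys (p j))" by (intro finite_SigmaI) auto
    then have "(SIGMA j:{..N}. Poly_Mapping.keys (p j)) = {}" using 0(1) card_0_eq by metis
    then have "Poly_Mapping.keys (p j) = {}" if "j \<le> N" for j using that by blast
    then have "p j = 0" for j using 0(4)[of j] keys_eq_empty[of "p j"] by (cases "j \<le> N") auto
    then have "p = \<zero>\<^bsub>Rees\<^esub>" unfolding rees_ops by blast
    then show ?case using additive_subgroup.zero_closed[OF ideal.axioms(1)[OF J]] by metis
  next
    case (Suc c)
    have L: "p j \<in> L j" for j using Suc(3) unfolding rees_carrier by blast
    have "(SIGMA j:{..N}. Poly_Mapping.keys (p j)) \<noteq> {}" using Suc(2) by (metis card.empty nat.distinct(1))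
    then obtain j m where jm: "j \<le> N" "m \<in> Poly_Mapping.keys (p j)" by blast
    define c' where "c' = Poly_Mapping.lookup (p j) m"
    have "m \<in> multiples n (nfold_sums G j)" using L[of j] jm(2) unfolding polys_on_def by blast
    then obtain a b where ab: "m = a + b" "a \<in> nfold_sums G j" "b \<in> var_monos n"
      unfolding multiples_def by blast
    have "mdeg n m \<noteq> j * e"
      using Suc(4)[of j] jm(2) unfolding slice_def restrict_keys_eq_0_iff by blast
    then have "b \<noteq> 0" using ab mdeg_nfold by auto
    then obtain i b' where i: "i \<in> {1..n}" "b' \<in> var_monos n" "b = Poly_Mapping.single i 1 + b'"
      using var_monos_split ab(3) by metis
    define x where "x = const_poly (Poly_Mapping.single (Poly_Mapping.single i 1) 1)"
    define y where "y = (\<lambda>k. if k = j then Poly_Mapping.single (a + b') c' else 0)"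
    \<comment> \<open>\<open>p'\<close> is \<open>p\<close> without the term that equals \<open>x\<close> times \<open>y\<close>.\<close>
    define p' where "p' = p(j := p j - Poly_Mapping.single m c')"
    have si: "Poly_Mapping.single i 1 \<in> units" using i(1) unfolding units_def by blast
    have xg: "x \<in> const_poly ` polys_on (multiples n units)"
      unfolding x_def using si subset_multiples[of units n] by (intro imageI) (auto simp: polys_on_def)
    have y: "y \<in> carrier Rees"
      unfolding y_def using ab(2) i(2) by (intro rees_term polys_onI) (auto simp: multiples_def)
    have xJ: "x \<in> mR" and xc: "x \<in> carrier Rees" using xg gJ gens by blast+
    have xy: "(x \<otimes>\<^bsub>Rees\<^esub> y) k = (if k = j then Poly_Mapping.single m c' else 0)" for k
    proof -
      have "(x \<otimes>\<^bsub>Rees\<^esub> y) k = (\<Sum>l\<le>k. x l * y (k - l))"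
        unfolding rees_ops(1)[OF xc y] ..
      also have "\<dots> = (\<Sum>l\<in>{0}. x l * y (k - l))"
        by (rule sum.mono_neutral_right) (auto simp: x_def const_poly_def)
      also have "\<dots> = (if k = j then Poly_Mapping.single m c' else 0)"
        by (simp add: x_def y_def const_poly_def mult_single ab(1) i(3) add_ac)
      finally show ?thesis .
    qed
    have xyJ: "x \<otimes>\<^bsub>Rees\<^esub> y \<in> mR" by (rule ideal.I_r_closed[OF J xJ y])
    have keys': "Poly_Mapping.keys (p' k) = (if k = j then Poly_Mapping.keys (p j) - {m} else Poly_Mapping.keys (p k))" for k
      by (auto simp: p'_def in_keys_iff lookup_minus lookup_single when_def c'_def split: if_splits)
    have p'L: "p' k \<in> L k" for k
      using L[of k] unfolding polys_on_def mem_Collect_eq keys' by auto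
    have p'N: "p' k = 0" if "k > N" for k using Suc(5)[OF that] that jm(1) by (auto simp: p'_def)
    have p': "p' \<in> carrier Rees" unfolding rees_carrier using p'L p'N by blast
    have "slice k (p' k) = 0" for k
      using Suc(4)[of k] keys'[of k] unfolding slice_def restrict_keys_eq_0_iff by auto
    moreover have "c = card (SIGMA j:{..N}. Poly_Mapping.keys (p' j))"
    proof -
      have eq: "(SIGMA j:{..N}. Poly_Mapping.keys (p' j)) = (SIGMA j:{..N}. Poly_Mapping.keys (p j)) - {(j, m)}"
        by (auto simp: keys' split: if_splits)
      then show ?thesis using Suc(2) jm unfolding eq by (simp add: card_Diff_singleton)
    qed
    ultimately have p'J: "p' \<in> mR" using Suc(1)[of p'] p' p'N by blast
    have xyc: "x \<otimes>\<^bsub>Rees\<^esub> y \<in> carrier Rees" using ideal.Icarr[OF J xyJ] .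
    have "p = p' \<oplus>\<^bsub>Rees\<^esub> (x \<otimes>\<^bsub>Rees\<^esub> y)"
      unfolding rees_ops(2)[OF p' xyc] by (auto simp: xy p'_def fun_eq_iff)
    then show ?case
      using additive_subgroup.a_closed[OF ideal.axioms(1)[OF J] p'J xyJ] by metis
  qed
qed

lemma kernel_initial_part: "a_kernel Rees T initial_part = mR"
proof
  interpret h: ring_hom_ring Rees T initial_part by (rule ring_hom_ring_initial_part)
  have mem: "p \<in> a_kernel Rees T initial_part \<longleftrightarrow> p \<in> carrier Rees \<and> initial_part p = 0" for p
    unfolding a_kernel_def' by simp
  show "a_kernel Rees T initial_part \<subseteq> mR"
    using mem kernel_slices kernel_subset_mR by blast
  have "const_poly a \<in> a_kernel Rees T initial_part" if a: "a \<in> polys_on (multiples n units)" for a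
  proof -
    have "initial_part (const_poly a) = slice 0 a"
      using initial_part_eq[of 0 "const_poly a"] by (simp add: const_poly_def)
    also have "\<dots> = 0"
      unfolding slice_def restrict_keys_eq_0_iff
      using a mdeg_eq_0_iff[of _ n] zero_not_multiple multiples_subset_var_monos[OF units_var_monos]
      unfolding polys_on_def by auto
    finally show ?thesis using const_poly_rees a mmax_subset mem by blast
  qed
  then show "mR \<subseteq> a_kernel Rees T initial_part"
    by (intro h.R.genideal_minimal h.kernel_is_ideal) blast
qed

theorem fiber_cone_iso: "fiber_cone R (graded_max_ideal n) I \<simeq> (monoid_algebra M :: ((nat \<Rightarrow>\<^sub>0 nat) \<Rightarrow>\<^sub>0 'k) ring)"
proof -
  interpret h: ring_hom_ring Rees T initial_part by (rule ring_hom_ring_initial_part)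
  have "Rees Quot mR \<simeq> T\<lparr>carrier := initial_part ` carrier Rees\<rparr>"
    using h.FactRing_iso_set_aux unfolding kernel_initial_part is_ring_iso_def by blast
  then show ?thesis
    unfolding initial_part_image fiber_cone_def graded_max_ideal_eq mR_eq
    by (simp add: monoid_algebra_def)
qed

lemma fiber_cone_cring: "cring (fiber_cone R (graded_max_ideal n) I)"
proof -
  interpret h: ring_hom_ring Rees T initial_part by (rule ring_hom_ring_initial_part)
  show ?thesis
    unfolding fiber_cone_def graded_max_ideal_eq mR_eq kernel_initial_part[symmetric]
    by (rule ideal.quotient_is_cring[OF h.kernel_is_ideal rees_cring])
qed

text \<open>
  The analytic spread is thus the Krull dimension of a semigroup algebra, for which upper and
  lower bounds are proved separately.
\<close>

theorem analytic_spread_equigenerated: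
  "analytic_spread (mpoly_ring n) (graded_max_ideal n) I
     = krull_dim (monoid_algebra M :: ((nat \<Rightarrow>\<^sub>0 nat) \<Rightarrow>\<^sub>0 'k) ring)"
  unfolding analytic_spread_def mpoly_ring_eq
  by (rule krull_dim_iso[OF fiber_cone_cring monoid_algebra_cring[OF nfold_sums_submonoid] fiber_cone_iso])

end

section \<open>Chains of primes give algebraically independent elements\<close>

locale submonoid_algebra =
  fixes T :: "'a::comm_monoid_add set" and field_type :: "'k::field itself"
  assumes zero_mem: "0 \<in> T" and add_mem: "\<And>a b. a \<in> T \<Longrightarrow> b \<in> T \<Longrightarrow> a + b \<in> T"
begin

abbreviation "A \<equiv> monoid_algebra T :: ('a \<Rightarrow>\<^sub>0 'k) ring"

lemma A_mult: "f \<in> polys_on T \<Longrightarrow> g \<in> polys_on T \<Longrightarrow> f * g \<in> polys_on T"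
  for f g :: "'a \<Rightarrow>\<^sub>0 'k"
  using polys_on_mult[OF add_mem] .

lemma A_scalar: "Poly_Mapping.single 0 (c :: 'k) \<in> polys_on T"
  using zero_mem by (auto simp: polys_on_def)

lemma A_power: "f \<in> polys_on T \<Longrightarrow> f ^ k \<in> polys_on T" for f :: "'a \<Rightarrow>\<^sub>0 'k"
  using A_scalar[of 1] by (induction k) (auto intro: A_mult)

lemma prime_props:
  assumes "primeideal P A"
  shows "P \<subseteq> polys_on T" "a \<in> P \<Longrightarrow> b \<in> P \<Longrightarrow> a - b \<in> P"
    "a \<in> P \<Longrightarrow> b \<in> polys_on T \<Longrightarrow> b * a \<in> P"
    "a * b \<in> P \<Longrightarrow> a \<in> polys_on T \<Longrightarrow> b \<in> polys_on T \<Longrightarrow> a \<in> P \<or> b \<in> P"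
    "1 \<notin> P" "0 \<in> P"
proof -
  interpret P: primeideal P A by fact
  note add = P.is_additive_subgroup
  show sub: "P \<subseteq> polys_on T" using P.a_subset by simp
  have neg: "- b \<in> P" if "b \<in> P" for b
    using P.I_l_closed[OF that, of "- 1"] polys_on_uminus[OF A_scalar[of 1]] by simp
  show "a - b \<in> P" if "a \<in> P" "b \<in> P"
    using additive_subgroup.a_closed[OF add that(1) neg[OF that(2)]] by simp
  show "b * a \<in> P" if "a \<in> P" "b \<in> polys_on T"
    using P.I_l_closed[of a b] that by simp
  show "a \<in> P \<or> b \<in> P" if "a * b \<in> P" "a \<in> polys_on T" "b \<in> polys_on T"
    using P.I_prime[of a b] that by simp
  show "1 \<notin> P" using P.one_imp_carrier P.I_notcarr by auto
  show "0 \<in> P" using additive_subgroup.zero_closed[OF add] by simp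
qed

lemma prime_power:
  assumes P: "primeideal P A" and x: "x \<in> polys_on T" "x \<notin> P"
  shows "x ^ k \<notin> P"
proof (induction k)
  case 0
  then show ?case using prime_props(5)[OF P] by simp
next
  case (Suc k)
  then show ?case using prime_props(4)[OF P, of x "x ^ k"] x A_power[OF x(1), of k] by auto
qed

end

text \<open>
  The monomial \<open>\<Prod>\<^sub>i x\<^sub>i ^ a\<^sub>i\<close> with its exponents given as a list. The recursion shifts the
  indeterminates, which matches the passage from a chain of primes to its tail.
\<close>

primrec power_product :: "(nat \<Rightarrow> 'a::comm_monoid_mult) \<Rightarrow> nat list \<Rightarrow> 'a" where
  "power_product x [] = 1"
| "power_product x (a # as) = x 0 ^ a * power_product (\<lambda>i. x (Suc i)) as"

context submonoid_algebra
begin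

lemma power_product_mem:
  "(\<And>i. i < length \<alpha> \<Longrightarrow> x i \<in> polys_on T) \<Longrightarrow> power_product x \<alpha> \<in> polys_on T"
  for x :: "nat \<Rightarrow> 'a \<Rightarrow>\<^sub>0 'k"
proof (induction \<alpha> arbitrary: x)
  case Nil
  then show ?case using A_scalar[of 1] by simp
next
  case (Cons a \<alpha>)
  have "power_product (\<lambda>i. x (Suc i)) \<alpha> \<in> polys_on T"
    by (rule Cons.IH) (use Cons.prems in auto)
  moreover have "x 0 \<in> polys_on T" using Cons.prems by auto
  ultimately show ?case by (auto intro: A_mult A_power)
qed

text \<open>
  Elements \<open>x\<^sub>i \<in> P\<^bsub>i+1\<^esub> - P\<^sub>i\<close> picked along a chain of primes are algebraically independent modulo
  \<open>P\<^sub>0\<close>. Write a polynomial expression in them as \<open>x\<^sub>0\<^sup>a (x\<^sub>0 H + S)\<close> with \<open>a\<close> the least exponent of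
  \<open>x\<^sub>0\<close>, so that \<open>S\<close> is a nontrivial expression in \<open>x\<^sub>1, x\<^sub>2, \<dots>\<close>. If the expression were in \<open>P\<^sub>0\<close>, then
  so would be \<open>x\<^sub>0 H + S\<close>, as \<open>x\<^sub>0 \<notin> P\<^sub>0\<close>. Since \<open>x\<^sub>0 \<in> P\<^sub>1\<close>, this puts \<open>S\<close> into \<open>P\<^sub>1\<close>, which induction
  on the chain excludes. At the end of the chain \<open>S\<close> is a nonzero constant.
\<close>

lemma prime_chain_independent:
  fixes P :: "nat \<Rightarrow> ('a \<Rightarrow>\<^sub>0 'k) set" and c :: "nat list \<Rightarrow> 'k"
  assumes "\<And>i. i \<le> m \<Longrightarrow> primeideal (P i) A" "\<And>i. i < m \<Longrightarrow> P i \<subseteq> P (Suc i)"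
    and "\<And>i. i < m \<Longrightarrow> x i \<in> P (Suc i) - P i"
    and "finite E" "E \<noteq> {}" "\<And>\<alpha>. \<alpha> \<in> E \<Longrightarrow> length \<alpha> = m" "\<And>\<alpha>. \<alpha> \<in> E \<Longrightarrow> c \<alpha> \<noteq> 0"
  shows "(\<Sum>\<alpha>\<in>E. Poly_Mapping.single 0 (c \<alpha>) * power_product x \<alpha>) \<notin> P 0"
  using assms
proof (induction m arbitrary: P x E c)
  case 0
  have E: "E = {[]}" using 0(5,6) by auto
  note P = 0(1)[OF order_refl]
  show ?case
  proof
    assume "(\<Sum>\<alpha>\<in>E. Poly_Mapping.single 0 (c \<alpha>) * power_product x \<alpha>) \<in> P 0"
    then have "Poly_Mapping.single 0 (inverse (c [])) * Poly_Mapping.single 0 (c []) \<in> P 0"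
      using prime_props(3)[OF P _ A_scalar] by (simp add: E)
    then show False
      using 0(7)[of "[]"] prime_props(5)[OF P] by (simp add: mult_single E)
  qed
next
  case (Suc m)
  note P = Suc.prems(1) and sub = Suc.prems(2) and x = Suc.prems(3) and len = Suc.prems(6)
  have xT: "x i \<in> polys_on T" if "i < Suc m" for i
    using x[OF that] prime_props(1)[OF P, of "Suc i"] that by auto
  define x' where "x' = (\<lambda>i. x (Suc i))"
  have x'T: "power_product x' \<beta> \<in> polys_on T" if "length \<beta> = m" for \<beta>
    unfolding x'_def by (rule power_product_mem) (use xT that in auto)
  define a0 where "a0 = Min (hd ` E)"
  have a0_le: "a0 \<le> hd \<alpha>" if "\<alpha> \<in> E" for \<alpha>
    unfolding a0_def using that Suc.prems(4) by simp
  have "a0 \<in> hd ` E" unfolding a0_def using Suc.prems(4,5) by (intro Min_in) auto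
  then obtain \<alpha>0 where \<alpha>0: "\<alpha>0 \<in> E" "hd \<alpha>0 = a0" by auto
  \<comment> \<open>The terms in which the exponent of \<open>x\<^sub>0\<close> is least are those indexed by \<open>B\<close>.\<close>
  define B where "B = {\<beta>. a0 # \<beta> \<in> E}"
  define E' where "E' = E - (#) a0 ` B"
  have "tl \<alpha>0 \<in> B" using \<alpha>0 len[OF \<alpha>0(1)] unfolding B_def by (cases \<alpha>0) auto
  then have "B \<noteq> {}" by auto
  have CB: "(#) a0 ` B \<subseteq> E" unfolding B_def by auto
  have finB: "finite B" using finite_subset[OF CB Suc.prems(4)] by (rule finite_imageD) simp
  have lenB: "length \<beta> = m" if "\<beta> \<in> B" for \<beta> using len[of "a0 # \<beta>"] that unfolding B_def by simp
  have E': "\<alpha> = hd \<alpha> # tl \<alpha> \<and> hd \<alpha> > a0 \<and> length (tl \<alpha>) = m" if "\<alpha> \<in> E'" for \<alpha>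
  proof -
    have "\<alpha> \<in> E" using that unfolding E'_def by auto
    then obtain a \<beta> where \<alpha>: "\<alpha> = a # \<beta>" using len[of \<alpha>] by (cases \<alpha>) auto
    have "a \<noteq> a0" using that \<open>\<alpha> \<in> E\<close> unfolding E'_def B_def \<alpha> by auto
    then show ?thesis using a0_le[OF \<open>\<alpha> \<in> E\<close>] len[OF \<open>\<alpha> \<in> E\<close>] \<alpha> by simp
  qed
  define S where "S = (\<Sum>\<beta>\<in>B. Poly_Mapping.single 0 (c (a0 # \<beta>)) * power_product x' \<beta>)"
  define H where "H = (\<Sum>\<alpha>\<in>E'. Poly_Mapping.single 0 (c \<alpha>) * (x 0 ^ (hd \<alpha> - a0 - 1) * power_product x' (tl \<alpha>)))"
  have ST: "S \<in> polys_on T" unfolding S_def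
    by (intro polys_on_sum A_mult A_scalar x'T lenB)
  have HT: "H \<in> polys_on T" unfolding H_def
    using E' xT by (intro polys_on_sum A_mult A_scalar x'T A_power) auto
  have "(\<Sum>\<alpha>\<in>E. Poly_Mapping.single 0 (c \<alpha>) * power_product x \<alpha>)
      = (\<Sum>\<alpha>\<in>E'. Poly_Mapping.single 0 (c \<alpha>) * power_product x \<alpha>)
        + (\<Sum>\<alpha>\<in>(#) a0 ` B. Poly_Mapping.single 0 (c \<alpha>) * power_product x \<alpha>)"
    unfolding E'_def by (rule sum.subset_diff[OF CB Suc.prems(4)])
  also have "(\<Sum>\<alpha>\<in>(#) a0 ` B. Poly_Mapping.single 0 (c \<alpha>) * power_product x \<alpha>) = x 0 ^ a0 * S"
    by (subst sum.reindex) (simp_all add: S_def x'_def sum_distrib_left mult_ac)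
  also have "(\<Sum>\<alpha>\<in>E'. Poly_Mapping.single 0 (c \<alpha>) * power_product x \<alpha>) = x 0 ^ a0 * (x 0 * H)"
    unfolding H_def sum_distrib_left
  proof (rule sum.cong[OF refl])
    fix \<alpha> assume "\<alpha> \<in> E'"
    from E'[OF this] obtain a \<beta> where \<alpha>: "\<alpha> = a # \<beta>" "a > a0" by metis
    have "x 0 ^ a = x 0 ^ a0 * (x 0 * x 0 ^ (a - a0 - 1))"
      using \<alpha>(2) by (simp flip: power_Suc power_add)
    then show "Poly_Mapping.single 0 (c \<alpha>) * power_product x \<alpha> =
        x 0 ^ a0 * (x 0 * (Poly_Mapping.single 0 (c \<alpha>) * (x 0 ^ (hd \<alpha> - a0 - 1) * power_product x' (tl \<alpha>))))"
      by (simp add: \<alpha>(1) x'_def mult_ac)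
  qed
  finally have total: "(\<Sum>\<alpha>\<in>E. Poly_Mapping.single 0 (c \<alpha>) * power_product x \<alpha>) = x 0 ^ a0 * (x 0 * H + S)"
    by (simp add: distrib_left)
  show ?case
  proof
    assume "(\<Sum>\<alpha>\<in>E. Poly_Mapping.single 0 (c \<alpha>) * power_product x \<alpha>) \<in> P 0"
    then have "x 0 ^ a0 * (x 0 * H + S) \<in> P 0" unfolding total .
    moreover have "x 0 ^ a0 \<notin> P 0" using prime_power[OF P[of 0]] xT[of 0] x[of 0] by simp
    moreover have "x 0 * H + S \<in> polys_on T" using xT HT ST by (intro polys_on_add A_mult) auto
    ultimately have "x 0 * H + S \<in> P 0"
      using prime_props(4)[OF P[of 0], of "x 0 ^ a0" "x 0 * H + S"] A_power[OF xT] by blast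
    then have "x 0 * H + S \<in> P (Suc 0)" using sub[of 0] by auto
    moreover have "x 0 * H \<in> P (Suc 0)"
      using prime_props(3)[OF P[of "Suc 0"], of "x 0" H] x[of 0] HT by (simp add: mult.commute)
    ultimately have "(x 0 * H + S) - x 0 * H \<in> P (Suc 0)"
      by (intro prime_props(2)[OF P[of "Suc 0"]]) auto
    then have "S \<in> P (Suc 0)" by simp
    moreover have "S \<notin> P (Suc 0)" unfolding S_def
      by (rule Suc.IH[of "\<lambda>i. P (Suc i)" x' B "\<lambda>\<beta>. c (a0 # \<beta>)"])
         (use P sub x finB \<open>B \<noteq> {}\<close> lenB Suc.prems(7) in \<open>auto simp: x'_def B_def\<close>)
    ultimately show False by blast
  qed
qed

end

section \<open>The upper bound: counting monomials\<close>

definition exps_le :: "nat \<Rightarrow> ((nat \<Rightarrow>\<^sub>0 nat) \<Rightarrow>\<^sub>0 'k::zero) \<Rightarrow> bool" where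
  "exps_le C p \<longleftrightarrow> (\<forall>m\<in>Poly_Mapping.keys p. \<forall>i. Poly_Mapping.lookup m i \<le> C)"

lemma exps_le_mult:
  fixes p q :: "(nat \<Rightarrow>\<^sub>0 nat) \<Rightarrow>\<^sub>0 'k::comm_ring_1"
  assumes "exps_le C p" "exps_le D q"
  shows "exps_le (C + D) (p * q)"
  unfolding exps_le_def
proof (intro ballI allI)
  fix m i assume "m \<in> Poly_Mapping.keys (p * q)"
  then obtain a b where "m = a + b" "a \<in> Poly_Mapping.keys p" "b \<in> Poly_Mapping.keys q"
    using keys_mult[of p q] by blast
  then show "Poly_Mapping.lookup m i \<le> C + D"
    using assms unfolding exps_le_def by (simp add: lookup_add add_mono)
qed

lemma exps_le_one: "exps_le 0 (1 :: (nat \<Rightarrow>\<^sub>0 nat) \<Rightarrow>\<^sub>0 'k::comm_ring_1)"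
  by (simp add: exps_le_def)

lemma exps_le_power: "exps_le C p \<Longrightarrow> exps_le (k * C) (p ^ k)"
  for p :: "(nat \<Rightarrow>\<^sub>0 nat) \<Rightarrow>\<^sub>0 'k::comm_ring_1"
  by (induction k) (simp_all add: exps_le_one exps_le_mult)

lemma exps_le_power_product:
  fixes x :: "nat \<Rightarrow> (nat \<Rightarrow>\<^sub>0 nat) \<Rightarrow>\<^sub>0 'k::comm_ring_1"
  assumes "\<And>i. i < length \<alpha> \<Longrightarrow> exps_le C (x i)"
  shows "exps_le (sum_list \<alpha> * C) (power_product x \<alpha>)"
  using assms
proof (induction \<alpha> arbitrary: x)
  case (Cons a \<alpha>)
  have "exps_le (sum_list \<alpha> * C) (power_product (\<lambda>i. x (Suc i)) \<alpha>)"
    by (rule Cons.IH) (use Cons.prems in auto)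
  moreover have "exps_le (a * C) (x 0 ^ a)" using Cons.prems by (intro exps_le_power) auto
  ultimately show ?case by (simp add: exps_le_mult distrib_right)
qed (simp add: exps_le_one)

lemma exps_le_exists: "\<exists>C. exps_le C p"
proof -
  define S where "S = (\<Union>m\<in>Poly_Mapping.keys p. Poly_Mapping.lookup m ` Poly_Mapping.keys m)"
  have "finite S" unfolding S_def by auto
  then have *: "k \<le> Max (insert 0 S)" if "k \<in> insert 0 S" for k
    using that by (intro Max_ge) auto
  have "Poly_Mapping.lookup m i \<in> insert 0 S" if "m \<in> Poly_Mapping.keys p" for m i
    using that unfolding S_def by (cases "i \<in> Poly_Mapping.keys m") (blast, simp add: in_keys_iff)
  then show ?thesis unfolding exps_le_def using * by blast
qed

lemma exps_le_mono: "exps_le C p \<Longrightarrow> C \<le> D \<Longrightarrow> exps_le D p"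
  unfolding exps_le_def using le_trans by blast

text \<open>
  A polynomial of degree \<open>m\<close> in \<open>N\<close> outgrows one of degree \<open>s < m\<close>. The explicit
  \<open>N = (m B + 1)\<^sup>s\<close> works because \<open>m N B + 1 \<le> (m B + 1) (N + 1)\<close>, so the right-hand side is at
  most \<open>N (N + 1)\<^sup>s\<close>, while the left-hand side is at least \<open>(N + 1)\<^bsup>s+1\<^esup>\<close>.
\<close>

lemma polynomial_growth_bound:
  fixes s B m :: nat
  assumes "\<And>N. (N + 1) ^ m \<le> (m * N * B + 1) ^ s"
  shows "m \<le> s"
proof (rule ccontr)
  assume "\<not> m \<le> s"
  define N where "N = (m * B + 1) ^ s"
  have "(N + 1) ^ (s + 1) \<le> (N + 1) ^ m"
    using \<open>\<not> m \<le> s\<close> by (intro power_increasing) auto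
  also have "\<dots> \<le> (m * N * B + 1) ^ s" by (rule assms)
  also have "\<dots> \<le> ((m * B + 1) * (N + 1)) ^ s"
    by (intro power_mono) (auto simp: algebra_simps)
  also have "\<dots> = N * (N + 1) ^ s" by (simp only: power_mult_distrib N_def)
  finally show False by simp
qed

interpretation mpoly_space: vector_space "\<lambda>c p. Poly_Mapping.single 0 (c :: 'k::field) * (p :: 'a::comm_monoid_add \<Rightarrow>\<^sub>0 'k)"
  by unfold_locales (simp_all add: distrib_left distrib_right single_add mult_single flip: mult.assoc)

text \<open>
  A chain of \<open>m + 1\<close> primes gives \<open>m\<close> algebraically independent elements \<open>x\<^sub>i\<close>. The \<open>(N + 1)\<^sup>m\<close>
  monomials in the \<open>x\<^sub>i\<close> with exponents at most \<open>N\<close> are then linearly independent. If no exponent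
  occurring in an \<open>x\<^sub>i\<close> exceeds \<open>B\<close>, they lie in the span of the monomials in \<open>T\<close> with exponents at
  most \<open>m N B\<close>, and there are at most \<open>(m N B + 1)\<^sup>s\<close> of those.
\<close>

theorem krull_dim_submonoid_algebra_le:
  fixes T :: "(nat \<Rightarrow>\<^sub>0 nat) set"
  assumes T: "0 \<in> T" "\<And>a b. a \<in> T \<Longrightarrow> b \<in> T \<Longrightarrow> a + b \<in> T"
    and fin: "\<And>C. finite {m \<in> T. \<forall>i. Poly_Mapping.lookup m i \<le> C}"
    and growth: "\<And>C. card {m \<in> T. \<forall>i. Poly_Mapping.lookup m i \<le> C} \<le> (C + 1) ^ s"
  shows "krull_dim (monoid_algebra T :: ((nat \<Rightarrow>\<^sub>0 nat) \<Rightarrow>\<^sub>0 'k::field) ring) \<le> enat s"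
  unfolding krull_dim_def
proof (rule Sup_least, clarify)
  interpret submonoid_algebra T "TYPE('k)" by unfold_locales (rule T; assumption)+
  fix m and P :: "nat \<Rightarrow> ((nat \<Rightarrow>\<^sub>0 nat) \<Rightarrow>\<^sub>0 'k) set"
  assume P: "\<forall>i\<le>m. primeideal (P i) A" "\<forall>i<m. P i \<subset> P (Suc i)"
  have "\<forall>i. \<exists>x. i < m \<longrightarrow> x \<in> P (Suc i) - P i" using P(2) by blast
  then obtain x where x: "x i \<in> P (Suc i) - P i" if "i < m" for i by metis
  have xT: "x i \<in> polys_on T" if "i < m" for i
    using x[OF that] P(1) prime_props(1)[of "P (Suc i)"] that by (meson DiffD1 Suc_leI subsetD)
  have "\<forall>i. \<exists>b. exps_le b (x i)" using exps_le_exists by blast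
  then obtain b where b: "exps_le (b i) (x i)" for i by metis
  define B where "B = (\<Sum>i<m. b i)"
  have B: "exps_le B (x i)" if "i < m" for i
    by (rule exps_le_mono[OF b]) (use that in \<open>simp add: B_def member_le_sum\<close>)
  have "(N + 1) ^ m \<le> (m * N * B + 1) ^ s" for N
  proof -
    define E where "E = {\<alpha>. set \<alpha> \<subseteq> {..N} \<and> length \<alpha> = m}"
    have finE: "finite E" unfolding E_def by (rule finite_lists_length_eq) simp
    have cardE: "card E = (N + 1) ^ m" unfolding E_def by (subst card_lists_length_eq) auto
    define box where "box = {e \<in> T. \<forall>i. Poly_Mapping.lookup e i \<le> m * N * B}"
    have indep: "(\<Sum>\<alpha>\<in>F. Poly_Mapping.single 0 (c \<alpha>) * power_product x \<alpha>) \<noteq> 0"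
      if "F \<subseteq> E" "F \<noteq> {}" "\<And>\<alpha>. \<alpha> \<in> F \<Longrightarrow> c \<alpha> \<noteq> 0" for F c
      using prime_chain_independent[of m P x F c] that P x prime_props(6)[of "P 0"]
        finite_subset[OF that(1) finE] unfolding E_def by fastforce
    have inj: "inj_on (power_product x) E"
    proof (rule inj_onI, rule ccontr)
      fix \<alpha> \<beta> assume ab: "\<alpha> \<in> E" "\<beta> \<in> E" "power_product x \<alpha> = power_product x \<beta>" "\<alpha> \<noteq> \<beta>"
      have "(\<Sum>\<gamma>\<in>{\<alpha>, \<beta>}. Poly_Mapping.single 0 (if \<gamma> = \<alpha> then 1 else - 1) * power_product x \<gamma>) \<noteq> 0"
        by (rule indep) (use ab in auto)
      then show False using ab by (simp add: single_uminus)
    qed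
    have "mpoly_space.independent (power_product x ` E)"
    proof (rule mpoly_space.independent_if_scalars_zero)
      show "finite (power_product x ` E)" using finE by simp
    next
      fix f y assume f: "(\<Sum>y\<in>power_product x ` E. Poly_Mapping.single 0 (f y) * y) = 0"
        and y: "y \<in> power_product x ` E"
      define F where "F = {\<alpha> \<in> E. f (power_product x \<alpha>) \<noteq> 0}"
      have "0 = (\<Sum>\<alpha>\<in>E. Poly_Mapping.single 0 (f (power_product x \<alpha>)) * power_product x \<alpha>)"
        using f unfolding sum.reindex[OF inj] o_def by (rule sym)
      also have "\<dots> = (\<Sum>\<alpha>\<in>F. Poly_Mapping.single 0 (f (power_product x \<alpha>)) * power_product x \<alpha>)"
        by (rule sum.mono_neutral_right) (use finE in \<open>auto simp: F_def\<close>)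
      finally have sum0: "(\<Sum>\<alpha>\<in>F. Poly_Mapping.single 0 (f (power_product x \<alpha>)) * power_product x \<alpha>) = 0"
        by (rule sym)
      have "F = {}"
      proof (rule ccontr)
        assume "F \<noteq> {}"
        then show False by (rule indep[THEN notE, OF _ _ _ sum0, rotated]) (simp_all add: F_def)
      qed
      then show "f y = 0" using y unfolding F_def by blast
    qed
    moreover have "power_product x ` E \<subseteq> mpoly_space.span ((\<lambda>e. Poly_Mapping.single e 1) ` box)"
    proof
      fix y assume "y \<in> power_product x ` E"
      then obtain \<alpha> where \<alpha>: "\<alpha> \<in> E" "y = power_product x \<alpha>" by blast
      have len: "length \<alpha> = m" using \<alpha>(1) by (simp add: E_def)
      have yT: "y \<in> polys_on T" unfolding \<alpha>(2) by (rule power_product_mem) (use len xT in auto)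
      have "sum_list \<alpha> \<le> m * N"
        using \<alpha>(1) sum_list_mono[of \<alpha> "\<lambda>a. a" "\<lambda>_. N"] by (auto simp: E_def sum_list_triv subset_eq)
      moreover have "exps_le (sum_list \<alpha> * B) y"
        unfolding \<alpha>(2) by (rule exps_le_power_product) (use len B in auto)
      ultimately have "exps_le (m * N * B) y" by (auto elim: exps_le_mono)
      with yT have keys: "Poly_Mapping.keys y \<subseteq> box"
        unfolding box_def exps_le_def polys_on_def by blast
      show "y \<in> mpoly_space.span ((\<lambda>e. Poly_Mapping.single e 1) ` box)"
      proof (rule additive_closed_monomials)
        fix e assume "e \<in> Poly_Mapping.keys y"
        then have "Poly_Mapping.single e 1 \<in> mpoly_space.span ((\<lambda>e. Poly_Mapping.single e 1) ` box)"
          using keys by (intro mpoly_space.span_base) blast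
        from mpoly_space.span_scale[OF this, of "Poly_Mapping.lookup y e"]
        show "Poly_Mapping.single e (Poly_Mapping.lookup y e) \<in> mpoly_space.span ((\<lambda>e. Poly_Mapping.single e 1) ` box)"
          by (simp add: mult_single)
      qed (auto intro: mpoly_space.span_add mpoly_space.span_zero)
    qed
    ultimately have "card (power_product x ` E) \<le> card ((\<lambda>e. Poly_Mapping.single e (1::'k)) ` box)"
      using mpoly_space.independent_span_bound fin unfolding box_def by blast
    also have "\<dots> \<le> card box" using fin by (intro card_image_le) (simp add: box_def)
    also have "\<dots> \<le> (m * N * B + 1) ^ s" unfolding box_def by (rule growth)
    finally show ?thesis by (simp add: card_image[OF inj] cardE)
  qed
  then have "m \<le> s" by (rule polynomial_growth_bound)
  then show "enat m \<le> enat s" by simp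
qed

section \<open>The lower bound: primes of coordinate faces\<close>

lemma keys_add_nat: "Poly_Mapping.keys (a + b) = Poly_Mapping.keys a \<union> Poly_Mapping.keys (b :: nat \<Rightarrow>\<^sub>0 nat)"
  by (auto simp: in_keys_iff lookup_add)

lemma domain_monoid_algebra_UNIV: "domain (monoid_algebra UNIV :: ((nat \<Rightarrow>\<^sub>0 nat) \<Rightarrow>\<^sub>0 'k::field) ring)"
  by (intro domain.intro domain_axioms.intro monoid_algebra_cring) auto

text \<open>
  The polynomials all of whose monomials involve a variable in \<open>W\<close> are the kernel of the
  homomorphism that sets the variables in \<open>W\<close> to \<open>0\<close>. Its target is a domain, so they form a prime
  ideal. Enlarging \<open>W\<close> enlarges this prime strictly as soon as some monomial in \<open>T\<close> avoids the
  smaller set and meets the larger one.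
\<close>

theorem krull_dim_submonoid_algebra_ge:
  fixes T :: "(nat \<Rightarrow>\<^sub>0 nat) set" and W :: "nat \<Rightarrow> nat set"
  assumes T: "0 \<in> T" "\<And>a b. a \<in> T \<Longrightarrow> b \<in> T \<Longrightarrow> a + b \<in> T"
    and W: "\<And>i. i < s \<Longrightarrow> W i \<subseteq> W (Suc i)"
    and m: "\<And>i. i < s \<Longrightarrow> \<exists>m\<in>T. Poly_Mapping.keys m \<inter> W i = {} \<and> Poly_Mapping.keys m \<inter> W (Suc i) \<noteq> {}"
  shows "enat s \<le> krull_dim (monoid_algebra T :: ((nat \<Rightarrow>\<^sub>0 nat) \<Rightarrow>\<^sub>0 'k::field) ring)"
proof -
  let ?A = "monoid_algebra T :: ((nat \<Rightarrow>\<^sub>0 nat) \<Rightarrow>\<^sub>0 'k) ring" and ?S = "monoid_algebra UNIV :: ((nat \<Rightarrow>\<^sub>0 nat) \<Rightarrow>\<^sub>0 'k) ring"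
  have A: "cring ?A" by (rule monoid_algebra_cring[OF T])
  define F where "F i = {m :: nat \<Rightarrow>\<^sub>0 nat. Poly_Mapping.keys m \<inter> W i = {}}" for i
  define P where "P i = {p \<in> carrier ?A. restrict_keys (F i) p \<in> {\<zero>\<^bsub>?S\<^esub>}}" for i
  have mem: "p \<in> P i \<longleftrightarrow> p \<in> polys_on T \<and> (\<forall>m\<in>Poly_Mapping.keys p. Poly_Mapping.keys m \<inter> W i \<noteq> {})" for p i
    by (auto simp: P_def F_def restrict_keys_eq_0_iff)
  have "primeideal (P i) ?A" for i
  proof -
    have "ring_hom_ring ?A ?S (restrict_keys (F i))"
    proof (rule ring_hom_ringI2)
      show "ring ?A" using A by (rule cring.axioms(1))
      show "ring ?S" by (intro cring.axioms(1) domain.axioms(1) domain_monoid_algebra_UNIV)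
      show "restrict_keys (F i) \<in> ring_hom ?A ?S"
      proof (rule ring_hom_memI)
        fix p q
        have "restrict_keys (F i) (p * q) = restrict_keys (F i) p * restrict_keys (F i) q" for p q :: "(nat \<Rightarrow>\<^sub>0 nat) \<Rightarrow>\<^sub>0 'k"
          by (rule restrict_keys_mult) (auto simp: F_def keys_add_nat)
        then show "restrict_keys (F i) (p \<otimes>\<^bsub>?A\<^esub> q) = restrict_keys (F i) p \<otimes>\<^bsub>?S\<^esub> restrict_keys (F i) q"
          by simp
        show "restrict_keys (F i) \<one>\<^bsub>?A\<^esub> = \<one>\<^bsub>?S\<^esub>"
          by (simp add: F_def restrict_keys_id)
      qed (auto simp: polys_on_def restrict_keys_add)
    qed
    then show ?thesis
      unfolding P_def
      by (rule ring_hom_ring.primeideal_vimage[OF _ A domain.zeroprimeideal[OF domain_monoid_algebra_UNIV]])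
  qed
  moreover have "P i \<subset> P (Suc i)" if i: "i < s" for i
  proof -
    have "P i \<subseteq> P (Suc i)" using W[OF i] mem by blast
    moreover obtain m where "m \<in> T" "Poly_Mapping.keys m \<inter> W i = {}" "Poly_Mapping.keys m \<inter> W (Suc i) \<noteq> {}"
      using m[OF i] by blast
    then have "Poly_Mapping.single m 1 \<in> P (Suc i) - P i"
      unfolding Diff_iff mem by (simp add: polys_on_def)
    ultimately show ?thesis by blast
  qed
  ultimately show ?thesis unfolding krull_dim_def by (intro Sup_upper) blast
qed

section \<open>Complete spread multipartite hypergraphs\<close>

definition edge_exp :: "nat set \<Rightarrow> (nat \<Rightarrow>\<^sub>0 nat)" where
  "edge_exp E = (\<Sum>i\<in>E. Poly_Mapping.single i 1)"

lemma lookup_edge_exp: "finite E \<Longrightarrow> Poly_Mapping.lookup (edge_exp E) v = (if v \<in> E then 1 else 0)"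
  by (simp add: edge_exp_def lookup_sum lookup_single when_def)

lemma keys_edge_exp: "finite E \<Longrightarrow> Poly_Mapping.keys (edge_exp E) = E"
  by (intro Set.set_eqI) (simp add: in_keys_iff lookup_edge_exp)

lemma prod_var: "finite E \<Longrightarrow> (\<Prod>i\<in>E. var i) = (Poly_Mapping.single (edge_exp E) 1 :: 'k::field mpoly)"
proof (induction E rule: finite_induct)
  case (insert i E)
  then show ?case unfolding edge_exp_def by (simp add: var_def mult_single)
qed (simp add: edge_exp_def)

locale spread_hypergraph =
  fixes n d :: nat and t :: "nat \<Rightarrow> nat" and V :: "nat \<Rightarrow> nat set"
  assumes d: "d \<ge> 1"
    and V: "\<And>i. i \<in> {1..d} \<Longrightarrow> V i \<noteq> {}" "\<And>i. i \<in> {1..d} \<Longrightarrow> V i \<subseteq> {1..n}"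
    and disj: "disjoint_family_on V {1..d}"
    and no_isolated: "no_isolated_vertices (complete_spread_hypergraph d t V)"
begin

abbreviation "U \<equiv> (\<Union>i\<in>{1..d}. V i)"
abbreviation "lo j \<equiv> Min (V j)"
abbreviation "hi j \<equiv> Max (V j)"

lemma V_unique: "v \<in> V i \<Longrightarrow> v \<in> V j \<Longrightarrow> i \<in> {1..d} \<Longrightarrow> j \<in> {1..d} \<Longrightarrow> i = j"
  using disj unfolding disjoint_family_on_def by blast

lemma finite_V: "i \<in> {1..d} \<Longrightarrow> finite (V i)"
  using V(2) finite_subset by blast

lemma lo_mem: "i \<in> {1..d} \<Longrightarrow> lo i \<in> V i"
  using V finite_V by simp

lemma hi_mem: "i \<in> {1..d} \<Longrightarrow> hi i \<in> V i"
  using V finite_V by simp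

lemma spread_edgeE:
  assumes "E \<in> spread_edges d t V"
  obtains k where "E = k ` {1..d}" "\<forall>j\<in>{1..d}. k j \<in> V j"
    "\<forall>j\<in>{2..d}. int (k j) - int (k (j - 1)) \<ge> int (t (j - 1))"
    "\<forall>j\<in>{1..d}. E \<inter> V j = {k j}"
proof -
  from assms obtain k where k: "E = k ` {1..d}" "\<forall>j\<in>{1..d}. k j \<in> V j"
    "\<forall>j\<in>{2..d}. int (k j) - int (k (j - 1)) \<ge> int (t (j - 1))"
    unfolding spread_edges_def by blast
  have "E \<inter> V j = {k j}" if j: "j \<in> {1..d}" for j
  proof
    show "{k j} \<subseteq> E \<inter> V j" using j k by blast
    show "E \<inter> V j \<subseteq> {k j}"
    proof
      fix v assume "v \<in> E \<inter> V j"
      then obtain i where "i \<in> {1..d}" "v = k i" "v \<in> V j" using k(1) by blast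
      then show "v \<in> {k j}" using V_unique[of v i j] k(2) j by blast
    qed
  qed
  then show thesis using k by (intro that[of k]) blast+
qed

lemma vertex_in_edge:
  assumes "v \<in> V j" "j \<in> {1..d}"
  obtains k where "k j = v" "\<forall>j\<in>{1..d}. k j \<in> V j"
    "\<forall>j\<in>{2..d}. int (k j) - int (k (j - 1)) \<ge> int (t (j - 1))"
proof -
  have "v \<in> U" using assms by blast
  then obtain E where E: "E \<in> spread_edges d t V" "v \<in> E"
    using no_isolated unfolding no_isolated_vertices_def complete_spread_hypergraph_def by auto
  from E(1) obtain k where "E = k ` {1..d}" and k: "\<forall>j\<in>{1..d}. k j \<in> V j"
    "\<forall>j\<in>{2..d}. int (k j) - int (k (j - 1)) \<ge> int (t (j - 1))"
    "\<forall>j\<in>{1..d}. E \<inter> V j = {k j}" by (rule spread_edgeE)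
  have "v \<in> {k j}" using bspec[OF k(3) assms(2)] E(2) assms(1) by blast
  then have "k j = v" by simp
  then show thesis using k(1,2) by (intro that[of k]) blast+
qed

lemma gap_lo:
  assumes "v \<in> V j" "j \<in> {2..d}"
  shows "int v - int (lo (j - 1)) \<ge> int (t (j - 1))"
proof -
  have j: "j \<in> {1..d}" "j - 1 \<in> {1..d}" using assms(2) by auto
  obtain k where k: "k j = v" "\<forall>j\<in>{1..d}. k j \<in> V j"
    "\<forall>j\<in>{2..d}. int (k j) - int (k (j - 1)) \<ge> int (t (j - 1))"
    using vertex_in_edge[OF assms(1) j(1)] by blast
  have "lo (j - 1) \<le> k (j - 1)" using Min_le[OF finite_V[OF j(2)] bspec[OF k(2) j(2)]] .
  then show ?thesis using bspec[OF k(3) assms(2)] k(1) by linarith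
qed

lemma gap_hi:
  assumes "v \<in> V (j - 1)" "j \<in> {2..d}"
  shows "int (hi j) - int v \<ge> int (t (j - 1))"
proof -
  have j: "j \<in> {1..d}" "j - 1 \<in> {1..d}" using assms(2) by auto
  obtain k where k: "k (j - 1) = v" "\<forall>j\<in>{1..d}. k j \<in> V j"
    "\<forall>j\<in>{2..d}. int (k j) - int (k (j - 1)) \<ge> int (t (j - 1))"
    using vertex_in_edge[OF assms(1) j(2)] by blast
  have "k j \<le> hi j" using Max_ge[OF finite_V[OF j(1)] bspec[OF k(2) j(1)]] .
  then show ?thesis using bspec[OF k(3) assms(2)] k(1) by linarith
qed

text \<open>
  In an edge through \<open>v \<in> V\<^sub>j\<close>, moving the vertex in \<open>V\<^bsub>j-1\<^esub>\<close> down to the minimum, or the one in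
  \<open>V\<^bsub>j+1\<^esub>\<close> up to the maximum, does not shrink the gaps to \<open>v\<close>. As no vertex is isolated, this
  applies to every vertex, in particular to all minima and maxima. So the minima below \<open>j\<close>,
  then \<open>v\<close>, then the maxima above \<open>j\<close> keep all required distances.
\<close>

lemma staircase_edge:
  assumes "v \<in> V j" "j \<in> {1..d}"
  shows "(\<lambda>i. if i < j then lo i else if i = j then v else hi i) ` {1..d} \<in> spread_edges d t V"
proof -
  let ?k = "\<lambda>i. if i < j then lo i else if i = j then v else hi i"
  have "?k i \<in> V i" if "i \<in> {1..d}" for i using lo_mem[OF that] hi_mem[OF that] assms(1) by auto
  moreover have "int (?k i) - int (?k (i - 1)) \<ge> int (t (i - 1))" if i: "i \<in> {2..d}" for i
  proof -
    have i': "i \<in> {1..d}" "i - 1 \<in> {1..d}" using i by auto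
    consider "i < j" | "i = j" | "i - 1 = j" "i > j" | "i - 1 > j" "i > j" by linarith
    then show ?thesis
    proof cases
      case 1
      then show ?thesis using gap_lo[OF lo_mem[OF i'(1)] i] by auto
    next
      case 2
      then show ?thesis using gap_lo[of v i] assms(1) i by auto
    next
      case 3
      then show ?thesis using gap_hi[of v i] assms(1) i by auto
    next
      case 4
      then show ?thesis using gap_hi[OF hi_mem[OF i'(2)] i] by auto
    qed
  qed
  ultimately show ?thesis unfolding spread_edges_def by blast
qed

abbreviation "G \<equiv> edge_exp ` spread_edges d t V"
abbreviation "M \<equiv> (\<Union>j. nfold_sums G j)"

lemma edge_props:
  assumes "E \<in> spread_edges d t V"
  shows "finite E" "E \<subseteq> U" "card E = d" "E \<subseteq> {1..n}"
proof -
  from assms obtain k where k: "E = k ` {1..d}" "\<forall>j\<in>{1..d}. k j \<in> V j"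
    "\<forall>j\<in>{2..d}. int (k j) - int (k (j - 1)) \<ge> int (t (j - 1))"
    "\<forall>j\<in>{1..d}. E \<inter> V j = {k j}" by (rule spread_edgeE)
  show "finite E" unfolding k(1) by simp
  have "k i \<in> U" if "i \<in> {1..d}" for i
    using that bspec[OF k(2) that] by (rule UN_I)
  then show "E \<subseteq> U" unfolding k(1) by (rule image_subsetI)
  moreover have "U \<subseteq> {1..n}" by (rule UN_least[OF V(2)])
  ultimately show "E \<subseteq> {1..n}" by (rule subset_trans)
  have "inj_on k {1..d}"
  proof (rule inj_onI)
    fix i j assume ij: "i \<in> {1..d}" "j \<in> {1..d}" "k i = k j"
    show "i = j"
      by (rule V_unique[OF bspec[OF k(2) ij(1)] _ ij(1,2)]) (use bspec[OF k(2) ij(2)] ij(3) in simp)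
  qed
  then show "card E = d" unfolding k(1) by (simp add: card_image)
qed

lemma edge_exps_var_monos: "G \<subseteq> var_monos n"
proof (rule image_subsetI)
  fix E assume "E \<in> spread_edges d t V"
  then show "edge_exp E \<in> var_monos n"
    using edge_props(4) unfolding var_monos_def by (simp add: keys_edge_exp edge_props(1))
qed

lemma mdeg_edge_exp:
  assumes "E \<in> spread_edges d t V"
  shows "mdeg n (edge_exp E) = d"
proof -
  have "mdeg n (edge_exp E) = (\<Sum>i\<in>{1..n}. if i \<in> E then 1 else 0)"
    unfolding mdeg_def lookup_edge_exp[OF edge_props(1)[OF assms]] ..
  also have "\<dots> = (\<Sum>i\<in>E. 1)"
    by (rule sum.mono_neutral_cong_right) (use edge_props(4)[OF assms] in auto)
  finally show ?thesis using edge_props(3)[OF assms] by simp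
qed

lemma nfold_degree:
  assumes "j \<in> {1..d}"
  shows "m \<in> nfold_sums G k \<Longrightarrow> (\<Sum>v\<in>V j. Poly_Mapping.lookup m v) = k"
proof (induction k arbitrary: m)
  case (Suc k)
  then obtain a E where m: "m = a + edge_exp E" "a \<in> nfold_sums G k" "E \<in> spread_edges d t V"
    unfolding nfold_sums.simps by blast
  from m(3) obtain f where "\<forall>j\<in>{1..d}. E \<inter> V j = {f j}" by (rule spread_edgeE)
  then have e: "E \<inter> V j = {f j}" using assms by (rule bspec)
  have "(\<Sum>v\<in>V j. Poly_Mapping.lookup (edge_exp E) v) = (\<Sum>v\<in>E \<inter> V j. 1)"
    unfolding lookup_edge_exp[OF edge_props(1)[OF m(3)]]
    by (rule sum.mono_neutral_cong_right) (use finite_V[OF assms] in auto)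
  then show ?case using Suc.IH[OF m(2)] by (simp add: m(1) lookup_add sum.distrib e)
qed simp

lemma nfold_keys: "m \<in> nfold_sums G k \<Longrightarrow> Poly_Mapping.keys m \<subseteq> U"
proof (induction k arbitrary: m)
  case (Suc k)
  then obtain a E where m: "m = a + edge_exp E" "a \<in> nfold_sums G k" "E \<in> spread_edges d t V"
    unfolding nfold_sums.simps by blast
  have "Poly_Mapping.keys (edge_exp E) \<subseteq> U"
    unfolding keys_edge_exp[OF edge_props(1)[OF m(3)]] by (rule edge_props(2)[OF m(3)])
  then show ?case unfolding m(1) keys_add_nat using Suc.IH[OF m(2)] by blast
qed simp

text \<open>
  All vertices except the least ones of \<open>V\<^sub>1, \<dots>, V\<^bsub>d-1\<^esub>\<close>. This set of \<open>r - d + 1\<close> vertices serves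
  both bounds: the exponents at \<open>D\<close> determine a monomial of the edge algebra, and eliminating the
  vertices of \<open>D\<close> one by one yields the chain of primes.
\<close>

definition "D = U - (\<lambda>j. lo j) ` {1..<d}"

lemma finite_D: "finite D"
  unfolding D_def using finite_V by auto

lemma card_D: "card D = card U - d + 1"
proof -
  have fU: "finite U" using finite_V by auto
  have inj: "inj_on (\<lambda>j. lo j) {1..d}"
  proof (rule inj_onI)
    fix i j assume "i \<in> {1..d}" "j \<in> {1..d}" "lo i = lo j"
    then show "i = j" using V_unique[of "lo i" i j] lo_mem[of i] lo_mem[of j] by simp
  qed
  have "(\<lambda>j. lo j) ` {1..d} \<subseteq> U" using lo_mem by blast
  from card_mono[OF fU this] have "d \<le> card U" using card_image[OF inj] by simp
  moreover have "card ((\<lambda>j. lo j) ` {1..<d}) = d - 1"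
    by (subst card_image[OF inj_on_subset[OF inj]]) auto
  moreover have "(\<lambda>j. lo j) ` {1..<d} \<subseteq> U" using lo_mem by force
  ultimately show ?thesis unfolding D_def using d by (subst card_Diff_subset) auto
qed

lemma V_minus_lo_D:
  assumes "j \<in> {1..d}" "v \<in> V j" "j = d \<or> v \<noteq> lo j"
  shows "v \<in> D"
  unfolding D_def
proof
  show "v \<in> U" using assms by blast
  show "v \<notin> (\<lambda>j. lo j) ` {1..<d}"
  proof
    assume "v \<in> (\<lambda>j. lo j) ` {1..<d}"
    then obtain i where i: "i \<in> {1..<d}" "v = lo i" by blast
    then have "i = j" using V_unique[of v i j] lo_mem[of i] assms(1,2) by auto
    then show False using assms(3) i by auto
  qed
qed

text \<open>
  A product of \<open>k\<close> edges has degree \<open>k\<close> in the variables of each \<open>V\<^sub>j\<close>. As \<open>V\<^sub>d \<subseteq> D\<close>, the exponents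
  at \<open>D\<close> determine \<open>k\<close>, and then also the exponent of the one missing variable in each \<open>V\<^sub>j\<close>.
\<close>

lemma determined_by_D:
  assumes "m \<in> M" "m' \<in> M" and eq: "\<And>v. v \<in> D \<Longrightarrow> Poly_Mapping.lookup m v = Poly_Mapping.lookup m' v"
  shows "m = m'"
proof -
  obtain k k' where k: "m \<in> nfold_sums G k" "m' \<in> nfold_sums G k'" using assms by blast
  have dd: "d \<in> {1..d}" using d by simp
  have "k = (\<Sum>v\<in>V d. Poly_Mapping.lookup m v)" using nfold_degree[OF dd k(1)] ..
  also have "\<dots> = (\<Sum>v\<in>V d. Poly_Mapping.lookup m' v)"
    using V_minus_lo_D[OF dd] eq by (intro sum.cong) auto
  also have "\<dots> = k'" using nfold_degree[OF dd k(2)] .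
  finally have kk: "k = k'" .
  show ?thesis
  proof (rule poly_mapping_eqI)
    fix v
    consider "v \<in> D" | "v \<notin> U" | j where "j \<in> {1..d}" "v = lo j" "v \<in> V j"
      unfolding D_def using lo_mem by force
    then show "Poly_Mapping.lookup m v = Poly_Mapping.lookup m' v"
    proof cases
      case 1
      then show ?thesis by (rule eq)
    next
      case 2
      then have "v \<notin> Poly_Mapping.keys m" "v \<notin> Poly_Mapping.keys m'"
        using nfold_keys k by blast+
      then show ?thesis by (simp add: in_keys_iff)
    next
      case 3
      have rest: "(\<Sum>w\<in>V j - {v}. Poly_Mapping.lookup m w) = (\<Sum>w\<in>V j - {v}. Poly_Mapping.lookup m' w)"
        using V_minus_lo_D[OF 3(1)] 3(2) eq by (intro sum.cong) auto
      have "Poly_Mapping.lookup m v + (\<Sum>w\<in>V j - {v}. Poly_Mapping.lookup m w) = k"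
        using nfold_degree[OF 3(1) k(1)] sum.remove[OF finite_V[OF 3(1)] 3(3)] by metis
      moreover have "Poly_Mapping.lookup m' v + (\<Sum>w\<in>V j - {v}. Poly_Mapping.lookup m' w) = k"
        using nfold_degree[OF 3(1) k(2)] sum.remove[OF finite_V[OF 3(1)] 3(3)] kk by metis
      ultimately show ?thesis using rest by linarith
    qed
  qed
qed

lemma box_growth:
  fixes C :: nat
  defines "box \<equiv> {m \<in> M. \<forall>i. Poly_Mapping.lookup m i \<le> C}"
  shows "finite box" "card box \<le> (C + 1) ^ card D"
proof -
  define \<rho> where "\<rho> = (\<lambda>m :: nat \<Rightarrow>\<^sub>0 nat. restrict (Poly_Mapping.lookup m) D)"
  have inj: "inj_on \<rho> box"
  proof (rule inj_onI)
    fix m m' assume "m \<in> box" "m' \<in> box" and eq: "\<rho> m = \<rho> m'"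
    then have "m \<in> M" "m' \<in> M" unfolding box_def by blast+
    moreover have "Poly_Mapping.lookup m v = Poly_Mapping.lookup m' v" if "v \<in> D" for v
      using fun_cong[OF eq, of v] that by (simp add: \<rho>_def)
    ultimately show "m = m'" by (rule determined_by_D)
  qed
  have sub: "\<rho> ` box \<subseteq> (\<Pi>\<^sub>E v\<in>D. {..C})"
    unfolding \<rho>_def box_def by (auto simp: PiE_def)
  have fin: "finite (\<Pi>\<^sub>E v\<in>D. {..C})" by (intro finite_PiE finite_D) simp
  show "finite box" using finite_imageD[OF finite_subset[OF sub fin] inj] .
  have "card box = card (\<rho> ` box)" using card_image[OF inj] ..
  also have "\<dots> \<le> card (\<Pi>\<^sub>E v\<in>D. {..C})" by (rule card_mono[OF fin sub])
  also have "\<dots> = (C + 1) ^ card D" by (simp add: card_PiE[OF finite_D])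
  finally show "card box \<le> (C + 1) ^ card D" .
qed

text \<open>
  The order of elimination is by increasing \<open>block\<close> and, within a block, from the largest vertex
  down; \<open>position\<close> encodes it as a number, using that vertices are at most \<open>n\<close>. In this order every
  eliminated vertex still lies on an edge that avoids the vertices eliminated before it.
\<close>

definition block :: "nat \<Rightarrow> nat" where
  "block v = (THE j. j \<in> {1..d} \<and> v \<in> V j)"

definition position :: "nat \<Rightarrow> nat" where
  "position v = block v * (n + 1) + (n - v)"

lemma block_eq: "j \<in> {1..d} \<Longrightarrow> v \<in> V j \<Longrightarrow> block v = j"
  unfolding block_def using V_unique by (intro the_equality) blast+

lemma position_less: "block v < block w \<Longrightarrow> position v < position w"
proof -
  assume "block v < block w"
  then have "(block v + 1) * (n + 1) \<le> block w * (n + 1)" by (intro mult_le_mono1) simp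
  then show ?thesis unfolding position_def by (simp add: algebra_simps)
qed

lemma position_inj: "inj_on position D"
proof (rule inj_onI)
  fix v w assume vw: "v \<in> D" "w \<in> D" "position v = position w"
  then have "block v = block w" using position_less by (metis less_irrefl linorder_neqE_nat)
  then have "n - v = n - w" using vw(3) unfolding position_def by simp
  moreover have "v \<le> n" "w \<le> n" using vw(1,2) V(2) unfolding D_def by fastforce+
  ultimately show "v = w" by simp
qed

definition eliminated :: "nat \<Rightarrow> nat set" where
  "eliminated i = {v \<in> D. \<exists>l<i. position v = enumerate (position ` D) l}"

text \<open>
  Let \<open>v \<in> V\<^sub>j\<close> be the next vertex to be eliminated. The edge that consists of minima below \<open>j\<close>, of
  \<open>v\<close>, and of maxima above \<open>j\<close> contains no vertex eliminated before: the minima below \<open>j\<close> are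
  not in \<open>D\<close>, and the vertices of the later blocks have a larger \<open>position\<close> than \<open>v\<close>.
\<close>

lemma elimination_chain:
  assumes i: "i < card D"
  shows "\<exists>m\<in>M. Poly_Mapping.keys m \<inter> eliminated i = {} \<and> Poly_Mapping.keys m \<inter> eliminated (Suc i) \<noteq> {}"
proof -
  have fin: "finite (position ` D)" using finite_D by simp
  have card: "card (position ` D) = card D" by (rule card_image[OF position_inj])
  have "enumerate (position ` D) i \<in> position ` D"
    by (rule finite_enumerate_in_set[OF fin]) (simp add: card i)
  then obtain v where v: "v \<in> D" "position v = enumerate (position ` D) i" by auto
  then obtain j where j: "j \<in> {1..d}" "v \<in> V j" unfolding D_def by blast
  define E where "E = (\<lambda>i. if i < j then lo i else if i = j then v else hi i) ` {1..d}"
  have E: "E \<in> spread_edges d t V" unfolding E_def by (rule staircase_edge[OF j(2,1)])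
  have "v \<in> E" unfolding E_def using j(1) by force
  moreover have "v \<in> eliminated (Suc i)" unfolding eliminated_def using v by blast
  moreover have "E \<inter> eliminated i = {}"
  proof (rule ccontr)
    assume "E \<inter> eliminated i \<noteq> {}"
    then obtain w l where w: "w \<in> E" "w \<in> D" "l < i" "position w = enumerate (position ` D) l"
      unfolding eliminated_def by blast
    have less: "position w < position v"
      unfolding v(2) w(4) by (rule finite_enumerate_mono[OF w(3) fin]) (simp add: card i)
    obtain l' where l': "l' \<in> {1..d}" "w = (if l' < j then lo l' else if l' = j then v else hi l')"
      using w(1) unfolding E_def by blast
    consider "l' < j" | "l' = j" | "l' > j" by linarith
    then show False
    proof cases
      case 1
      then have "w \<in> (\<lambda>j. lo j) ` {1..<d}" using l' j(1) by auto
      then show False using w(2) unfolding D_def by blast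
    next
      case 2
      then show False using l'(2) less by simp
    next
      case 3
      then have "w \<in> V l'" using l' hi_mem by simp
      then show False
        using position_less[of v w] block_eq[OF l'(1), of w] block_eq[OF j] 3 less by simp
    qed
  qed
  moreover have "edge_exp E \<in> nfold_sums G (Suc 0)" unfolding nfold_sums_1 using E by blast
  then have "edge_exp E \<in> M" by blast
  ultimately show ?thesis
    using keys_edge_exp[OF edge_props(1)[OF E]] by blast
qed

lemma krull_dim_edge_algebra: "krull_dim (monoid_algebra M :: 'k::field mpoly ring) = enat (card D)"
proof (rule antisym)
  show "krull_dim (monoid_algebra M :: 'k mpoly ring) \<le> enat (card D)"
    by (rule krull_dim_submonoid_algebra_le[OF nfold_sums_submonoid box_growth])
  show "enat (card D) \<le> krull_dim (monoid_algebra M :: 'k mpoly ring)"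
  proof (rule krull_dim_submonoid_algebra_ge[where W = eliminated, OF nfold_sums_submonoid _ elimination_chain])
    show "eliminated i \<subseteq> eliminated (Suc i)" for i
      unfolding eliminated_def using less_SucI by blast
  qed
qed

lemma edge_ideal_eq:
  "edge_ideal n (complete_spread_hypergraph d t V) = (polys_on (multiples n G) :: 'k::field mpoly set)"
proof -
  note G = edge_exps_var_monos
  have "(\<lambda>e. \<Prod>i\<in>e. var i) ` spread_edges d t V = (\<lambda>a. Poly_Mapping.single a (1::'k)) ` G"
    unfolding image_image using prod_var edge_props(1) by (intro image_cong) auto
  then show ?thesis
    unfolding edge_ideal_def mpoly_ring_eq complete_spread_hypergraph_def
    using genideal_monomials[OF G] by simp
qed

lemma equigenerated_edges: "equigenerated n d G"
proof
  show "G \<subseteq> var_monos n" by (rule edge_exps_var_monos)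
qed (use mdeg_edge_exp d in auto)

lemma analytic_spread_edge_ideal:
  "analytic_spread (mpoly_ring n :: 'k::field mpoly ring) (graded_max_ideal n)
     (edge_ideal n (complete_spread_hypergraph d t V)) = enat (card U - d + 1)"
  unfolding edge_ideal_eq equigenerated.analytic_spread_equigenerated[OF equigenerated_edges]
  by (simp only: krull_dim_edge_algebra card_D)

end

theorem lemma3p10:
  fixes n d r :: nat and t :: "nat \<Rightarrow> nat" and V :: "nat \<Rightarrow> nat set"
  assumes "n \<ge> 1" and "d \<ge> 1"
    and "\<forall>i\<in>{1..d-1}. t i \<ge> 1"
    and "\<forall>i\<in>{1..d}. V i \<noteq> {} \<and> V i \<subseteq> {1..n}"
    and "disjoint_family_on V {1..d}"
    and "\<forall>i\<in>{1..d}. \<forall>j\<in>{1..d}. i < j \<longrightarrow> (\<forall>p\<in>V i. \<forall>q\<in>V j. p < q)"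
    and "no_isolated_vertices (complete_spread_hypergraph d t V)"
    and "card (verts (complete_spread_hypergraph d t V)) = r"
  shows "analytic_spread (mpoly_ring n :: 'k::field mpoly ring) (graded_max_ideal n)
           (edge_ideal n (complete_spread_hypergraph d t V)) = enat (r - d + 1)"
proof -
  interpret spread_hypergraph n d t V
    by unfold_locales (use assms in auto)
  have "card (\<Union>i\<in>{1..d}. V i) = r" using assms(8) by (simp add: complete_spread_hypergraph_def)
  then show ?thesis using analytic_spread_edge_ideal by simp
qed

end
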